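(* Let $\lambda$ be a regular cardinal with $\lambda>\beth_\omega$. Then there is a cardinal $\kappa_0<\beth_\omega$ such that for every regular cardinal $\kappa$ with $\kappa_0\le\kappa<\beth_\omega$ the following three statements hold: (1) If $\lambda^{<\kappa}=\lambda$, then $\clubsuit^-(S^\lambda_\kappa)$ holds. Precisely, there is a sequence $\langle\mathcal{P}_\delta:\,\delta\in S^\lambda_\kappa\rangle$ such that (i) each $\mathcal{P}_\delta$ is a family of fewer than $\lambda$ elements of $[\delta]^{\le\kappa}$, and (ii) for every $A\in[\lambda]^\lambda$ there are stationarily many $\delta\in S^\lambda_\kappa$ such that for some $X\in\mathcal{P}_\delta$ we have $X\subseteq A$ and $\sup(X)=\delta$. (2) There is a sequence $\langle\mathcal{P}^0_\delta:\,\delta\in S^\lambda_\kappa\rangle$ such that each $\mathcal{P}^0_\delta$ is a family of fewer than $\lambda$ elements of $[\delta]^{\le\kappa}$, and for every $A\in[\lambda]^\lambda$ there is a club $E$ of $\lambda$ such that for every $\delta\in E\cap S^\lambda_\kappa$ there is $a\in\mathcal{P}^0_\delta$ with $\sup(A\cap a)=\delta$. (3) If for every cardinal $\theta<\lambda$ we have $\theta^{<\kappa}<\lambda$, then there is a sequence $\langle\mathcal{R}_\delta:\,\delta\in S^\lambda_\kappa\rangle$ such that each $\mathcal{R}_\delta$ is a family of fewer than $\lambda$ elements of $[\delta]^{\le\kappa}$, and for every sequence $\langle a_\delta:\,\delta\in S^\lambda_\kappa\rangle$ of sets such that each $a_\delta$ is a subset of $\delta$ of order type $\le\kappa$, there is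 a club $C$ of $\lambda$ such that $a_\delta\in\mathcal{R}_\delta$ for every $\delta\in C\cap S^\lambda_\kappa$.
   Context: For a regular cardinal $\kappa$ and an ordinal $\alpha>\kappa$, $S^\alpha_\kappa=\{\beta<\alpha:\,\mathrm{cf}(\beta)=\kappa\}$. For a set $X$ and cardinal $\nu$, $[X]^{\le\nu}$ (resp. $[X]^{\nu}$) is the set of subsets of $X$ of size $\le\nu$ (resp. exactly $\nu$). For a stationary $S\subseteq\lambda$, $\clubsuit^-(S)$ is the statement that there is a sequence $\langle\mathcal{P}_\delta:\,\delta\in S\rangle$ where each $\mathcal{P}_\delta$ is a family of fewer than $\lambda$ subsets of $\delta$, such that for every unbounded $A\subseteq\lambda$ there are stationarily many $\delta\in S$ for which some $X\in\mathcal{P}_\delta$ with $\sup(X)=\delta$ satisfies $X\subseteq A$. *)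

theory Defs
  imports Main
begin

notation
  ordLeq2 (infix \<open><=o\<close> 50) and
  ordLess2 (infix \<open><o\<close> 50) and
  ordIso2 (infix \<open>=o\<close> 50)

(* Conventions: lambda is represented by a cardinal order r (an initial well-order)
   on Field r.  Ordinals below lambda are the elements of Field r; the ordinal
   delta is identified with the set of its predecessors  underS r delta.
   Cardinals kappa < lambda are represented by cardinal orders k. *)

definition is_sup :: "'a rel \<Rightarrow> 'a set \<Rightarrow> 'a \<Rightarrow> bool" where
  "is_sup r X \<delta> \<longleftrightarrow> (\<forall>x\<in>X. (x, \<delta>) \<in> r) \<and>
     (\<forall>\<alpha>\<in>underS r \<delta>. \<exists>x\<in>X. \<alpha> \<noteq> x \<and> (\<alpha>, x) \<in> r)"

definition cof_is :: "'a rel \<Rightarrow> 'a \<Rightarrow> 'b rel \<Rightarrow> bool" where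
  "cof_is r \<delta> k \<longleftrightarrow>
     (\<exists>K. K \<subseteq> underS r \<delta> \<and> (\<forall>\<alpha>\<in>underS r \<delta>. \<exists>\<beta>\<in>K. (\<alpha>, \<beta>) \<in> r) \<and> card_of (K) =o k) \<and>
     (\<forall>K. K \<subseteq> underS r \<delta> \<and> (\<forall>\<alpha>\<in>underS r \<delta>. \<exists>\<beta>\<in>K. (\<alpha>, \<beta>) \<in> r) \<longrightarrow> k <=o card_of (K))"

definition S_cof :: "'a rel \<Rightarrow> 'b rel \<Rightarrow> 'a set" where
  "S_cof r k = {\<delta> \<in> Field r. cof_is r \<delta> k}"

definition club :: "'a rel \<Rightarrow> 'a set \<Rightarrow> bool" where
  "club r E \<longleftrightarrow> E \<subseteq> Field r \<and>
     (\<forall>\<alpha>\<in>Field r. \<exists>\<beta>\<in>E. \<alpha> \<noteq> \<beta> \<and> (\<alpha>, \<beta>) \<in> r) \<and>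
     (\<forall>\<delta>\<in>Field r. underS r \<delta> \<noteq> {} \<and> is_sup r (E \<inter> underS r \<delta>) \<delta> \<longrightarrow> \<delta> \<in> E)"

definition stationary :: "'a rel \<Rightarrow> 'a set \<Rightarrow> bool" where
  "stationary r S \<longleftrightarrow> S \<subseteq> Field r \<and> (\<forall>E. club r E \<longrightarrow> S \<inter> E \<noteq> {})"

definition small_subsets :: "'a rel \<Rightarrow> 'b rel \<Rightarrow> 'a \<Rightarrow> 'a set set" where
  "small_subsets r k \<delta> = {X. X \<subseteq> underS r \<delta> \<and> card_of (X) <=o k}"

definition beth_seq :: "(nat \<Rightarrow> 'a set) \<Rightarrow> bool" where
  "beth_seq B \<longleftrightarrow> card_of (B 0) =o card_of (UNIV :: nat set) \<and> (\<forall>n. card_of (B (Suc n)) =o card_of (Pow (B n)))"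

(* beth_omega < lambda  (|Union_n B n| = beth_omega) *)
definition beth_omega_less :: "'a rel \<Rightarrow> bool" where
  "beth_omega_less r \<longleftrightarrow> (\<exists>B :: nat \<Rightarrow> 'a set. beth_seq B \<and> card_of (\<Union>(range B)) <o r)"

definition less_beth_omega :: "'a rel \<Rightarrow> bool" where
  "less_beth_omega k \<longleftrightarrow> (\<exists>B :: nat \<Rightarrow> 'a set. beth_seq B \<and> (\<exists>n. k <o card_of (B n)))"

definition regular_cardinal :: "'a rel \<Rightarrow> bool" where
  "regular_cardinal k \<longleftrightarrow> Card_order k \<and> infinite (Field k) \<and> regularCard k"

end

theory Submission
  imports Defs
begin

text \<open>
  All three parts rest on a covering form of Shelah's revised GCH: for every ordinal \<open>d\<close> there
  is \<open>n\<close> and a family of at most \<open>|d|\<close> subsets of \<open>d\<close>, each of size below \<open>beth_omega\<close>, such that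
  every subset of \<open>d\<close> of size below \<open>beth_omega\<close> is a union of at most \<open>beth_n\<close> subsets of members.
  It is proved by induction on \<open>d\<close>, without pcf theory. If countable unions do not suffice, a
  maximality argument gives a \<open>\<sigma>\<close>-ideal \<open>J\<close> on a set \<open>I\<close> of size \<open>beth_n\<close> and \<open>|d|^+\<close> functions
  below some \<open>h\<close> on \<open>I\<close>, pairwise different modulo \<open>J\<close>. For minimal \<open>h\<close>, the sets on which \<open>h\<close>
  could be decreased form a proper \<open>\<sigma>\<close>-ideal \<open>K \<supseteq> J\<close>, and modulo \<open>K\<close> any \<open>|d|\<close> of the functions
  have an upper bound \<open>g < h\<close>. Coding the elements of \<open>d\<close> by functions below \<open>g\<close>, the covering
  families of the ordinals \<open>g i\<close> combine to one for \<open>d\<close>; by minimality of \<open>h\<close>, only \<open>|d|\<close> combinations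
  are needed modulo \<open>J\<close>.

  Regularity of \<open>\<lambda>\<close> makes \<open>n\<close> uniform. If \<open>A \<inter> \<delta>\<close> is unbounded in \<open>\<delta>\<close> and \<open>cf \<delta> = \<kappa> > beth_n\<close>, then a
  cofinal subset of size \<open>\<kappa>\<close> is split into fewer than \<open>\<kappa>\<close> pieces, one of which is cofinal; this
  gives (1) and (2) with \<open>X \<subseteq> A\<close>. In (3), each subset of \<open>\<delta>\<close> of size at most \<open>\<kappa>\<close> is a union of at
  most \<open>beth_n\<close> pieces, so by the hypothesis on exponentiation there are fewer than \<open>\<lambda>\<close> of them in all.
\<close>

unbundle cardinal_syntax

subsection \<open>Cardinalities of the beth sequence\<close>

lemma not_ordLeq_card: "\<not> |A| \<le>o |B| \<longleftrightarrow> |B| <o |A|"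
  using not_ordLeq_iff_ordLess[OF card_of_Well_order card_of_Well_order] by blast

lemma card_of_image_ordLeq:
  assumes "|A| \<le>o |C|"
  shows "|f ` A| \<le>o |C|"
  using card_of_image assms ordLeq_transitive by blast

lemma card_of_ordLeq_Field_cardSuc:
  assumes "\<not> |S| \<le>o |D|"
  shows "\<exists>u. inj_on u (Field (cardSuc |D| )) \<and> u ` Field (cardSuc |D| ) \<subseteq> S"
proof -
  have "cardSuc |D| \<le>o |S|"
    using assms cardSuc_least[OF card_of_Card_order card_of_Card_order] not_ordLeq_card by blast
  moreover have "|Field (cardSuc |D| )| =o cardSuc |D|"
    by (intro card_of_Field_ordIso cardSuc_Card_order card_of_Card_order)
  ultimately show ?thesis
    using ordIso_ordLeq_trans card_of_ordLeq by blast
qed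

lemma Field_cardSuc_not_ordLeq: "\<not> |Field (cardSuc |D| )| \<le>o |D|"
proof -
  have "|D| <o cardSuc |D|" by (simp add: cardSuc_greater card_of_Card_order)
  moreover have "|Field (cardSuc |D| )| =o cardSuc |D|"
    by (intro card_of_Field_ordIso cardSuc_Card_order card_of_Card_order)
  ultimately show ?thesis
    using not_ordLeq_card ordIso_symmetric ordLess_ordIso_trans by blast
qed

text \<open>Zorn's lemma for a symmetric relation. Later \<open>R\<close> says that two functions
  agree only on a set of an ideal, so every function outside \<open>M\<close> agrees with some
  member of \<open>M\<close> on a positive set.\<close>

lemma maximal_pairwise:
  assumes "\<And>f g. R f g \<Longrightarrow> R g f"
  shows "\<exists>M\<subseteq>S. (\<forall>f\<in>M. \<forall>g\<in>M. f \<noteq> g \<longrightarrow> R f g) \<and> (\<forall>f\<in>S. f \<in> M \<or> (\<exists>g\<in>M. \<not> R f g))"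
proof -
  define A where "A = {M. M \<subseteq> S \<and> (\<forall>f\<in>M. \<forall>g\<in>M. f \<noteq> g \<longrightarrow> R f g)}"
  have "\<Union>C \<in> A" if "subset.chain A C" for C
  proof -
    have *: "M \<in> A" if "M \<in> C" for M
      using that \<open>subset.chain A C\<close> unfolding subset.chain_def by blast
    have "R f g" if "f \<in> X" "X \<in> C" "g \<in> Y" "Y \<in> C" "f \<noteq> g" for f g X Y
    proof -
      have "X \<subseteq> Y \<or> Y \<subseteq> X"
        using that \<open>subset.chain A C\<close> unfolding subset_chain_def by blast
      then show ?thesis using that * unfolding A_def by blast
    qed
    then show ?thesis using * unfolding A_def by blast
  qed
  then obtain M where M: "M \<in> A" and max: "\<And>X. X \<in> A \<Longrightarrow> M \<subseteq> X \<Longrightarrow> X = M"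
    using subset_Zorn'[of A] by blast
  have "\<exists>g\<in>M. \<not> R f g" if "f \<in> S" "f \<notin> M" for f
  proof (rule ccontr)
    assume "\<not> ?thesis"
    then have "insert f M \<in> A" using M that(1) assms unfolding A_def by auto
    then show False using max[of "insert f M"] that(2) by blast
  qed
  then show ?thesis using M unfolding A_def by blast
qed

lemma beth_seq_less: "beth_seq B \<Longrightarrow> |B n| <o |B (Suc n)|"
  unfolding beth_seq_def using card_of_Pow ordIso_symmetric ordLess_ordIso_trans by blast

lemma beth_seq_mono:
  assumes "beth_seq B" "n \<le> m"
  shows "|B n| \<le>o |B m|"
  using assms(2)
proof (induction rule: dec_induct)
  case (step k)
  then show ?case
    using beth_seq_less[OF assms(1)] ordLess_imp_ordLeq ordLeq_transitive by blast
qed (simp add: card_of_refl ordIso_imp_ordLeq)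

lemma beth_seq_nat: "beth_seq B \<Longrightarrow> |UNIV :: nat set| \<le>o |B n|"
  using beth_seq_mono[of B 0 n] ordIso_symmetric ordIso_ordLeq_trans
  unfolding beth_seq_def by blast

lemma beth_seq_infinite: "beth_seq B \<Longrightarrow> infinite (B n)"
  using beth_seq_nat infinite_iff_card_of_nat by blast

lemma card_of_Pow_mono:
  assumes "|X| \<le>o |Y|"
  shows "|Pow X| \<le>o |Pow Y|"
proof -
  obtain f where "inj_on f X" "f ` X \<subseteq> Y" using assms card_of_ordLeq by metis
  then have "inj_on (image f) (Pow X)" "image f ` Pow X \<subseteq> Pow Y"
    by (auto simp: inj_on_image_Pow)
  then show ?thesis using card_of_ordLeq by blast
qed

lemma beth_seq_Pow:
  assumes "beth_seq B" "|X| \<le>o |B n|"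
  shows "|Pow X| \<le>o |B (Suc n)|"
  using assms card_of_Pow_mono ordIso_symmetric ordLeq_ordIso_trans
  unfolding beth_seq_def by blast

lemma beth_seq_Sigma:
  assumes "beth_seq B" "|X| \<le>o |B n|" "\<And>x. x \<in> X \<Longrightarrow> |Y x| \<le>o |B m|"
  shows "|Sigma X Y| \<le>o |B (max n m)|"
proof (rule card_of_Sigma_ordLeq_infinite)
  show "|X| \<le>o |B (max n m)|"
    using assms(2) beth_seq_mono[OF assms(1) max.cobounded1] ordLeq_transitive by blast
  show "\<forall>x\<in>X. |Y x| \<le>o |B (max n m)|"
    using assms(3) beth_seq_mono[OF assms(1) max.cobounded2] ordLeq_transitive by blast
qed (rule beth_seq_infinite[OF assms(1)])

subsection \<open>Families of functions modulo a countably complete ideal\<close>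

text \<open>Ideals here are proper. Countable completeness has two main uses: it excludes infinite
  descent modulo \<open>J\<close>, and it makes a parameter ranging over the naturals constant on a
  positive set.\<close>

definition sigma_ideal :: "'b set \<Rightarrow> 'b set set \<Rightarrow> bool" where
  "sigma_ideal I J \<longleftrightarrow> J \<subseteq> Pow I \<and> I \<notin> J \<and> (\<forall>X\<in>J. \<forall>Y\<subseteq>X. Y \<in> J) \<and>
     (\<forall>A :: nat \<Rightarrow> 'b set. (\<forall>n. A n \<in> J) \<longrightarrow> (\<Union>n. A n) \<in> J) \<and> {} \<in> J"

lemma sigma_ideal_subset: "sigma_ideal I J \<Longrightarrow> X \<in> J \<Longrightarrow> Y \<subseteq> X \<Longrightarrow> Y \<in> J"
  unfolding sigma_ideal_def by blast

lemma sigma_ideal_UN: "sigma_ideal I J \<Longrightarrow> (\<And>n::nat. A n \<in> J) \<Longrightarrow> (\<Union>n. A n) \<in> J"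
  unfolding sigma_ideal_def by blast

lemma sigma_ideal_Un:
  assumes "sigma_ideal I J" "X \<in> J" "Y \<in> J"
  shows "X \<union> Y \<in> J"
proof -
  have "(\<Union>n::nat. if n = 0 then X else Y) \<in> J"
    using assms by (intro sigma_ideal_UN) auto
  moreover have "(\<Union>n::nat. if n = 0 then X else Y) = X \<union> Y"
    by (auto split: if_splits)
  ultimately show ?thesis by simp
qed

section \<open>Large differing families from a failure of countable covering\<close>

definition differing :: "'b set set \<Rightarrow> 'b set \<Rightarrow> 'g set \<Rightarrow> ('g \<Rightarrow> 'b \<Rightarrow> 'c) \<Rightarrow> bool" where
  "differing J Y G f \<longleftrightarrow> (\<forall>a\<in>G. \<forall>b\<in>G. a \<noteq> b \<longrightarrow> {i \<in> Y. f a i = f b i} \<in> J)"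

text \<open>Size below beth_omega, when \<open>B\<close> is a beth sequence.\<close>

definition small :: "(nat \<Rightarrow> 'a set) \<Rightarrow> 'b set \<Rightarrow> bool" where
  "small B X \<longleftrightarrow> (\<exists>n. |X| \<le>o |B n| )"

text \<open>A covering version of the revised power of \<open>|D|\<close> being \<open>|D|\<close>:
  the members of \<open>P\<close> may have any size below beth_omega, and only the number of them
  needed for one set is limited to beth_n.\<close>

definition covered :: "(nat \<Rightarrow> 'a set) \<Rightarrow> nat \<Rightarrow> 'b set \<Rightarrow> bool" where
  "covered B n D \<longleftrightarrow> (\<exists>P. (\<forall>a\<in>P. a \<subseteq> D \<and> small B a) \<and> |P| \<le>o |D| \<and>
     (\<forall>x\<subseteq>D. small B x \<longrightarrow> (\<exists>Q\<subseteq>P. |Q| \<le>o |B n| \<and> x \<subseteq> \<Union>Q)))"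

text \<open>If every family of functions from \<open>B n\<close> to \<open>D\<close> differing
  pairwise modulo a sigma-ideal had size at most \<open>|D|\<close>, the ranges of maximal ones
  would cover. Indeed, for an uncovered \<open>x\<close> enumerated by \<open>f\<close>, the parts
  of \<open>B n\<close> with coverable image form a sigma-ideal \<open>J\<close>. By maximality
  \<open>f\<close> agrees on a \<open>J\<close>-positive set with some \<open>g\<close> whose range
  is a single member of \<open>P\<close>, which puts that set into \<open>J\<close>.\<close>

lemma differing_family_if_not_covered:
  fixes B :: "nat \<Rightarrow> 'a set" and D :: "'b set"
  assumes B: "beth_seq B" and D: "\<And>n. |B n| \<le>o |D|" and nc: "\<not> covered B 0 D"
  shows "\<exists>n J f. sigma_ideal (B n) J \<and> (\<forall>a\<in>Field (cardSuc |D| ). \<forall>i\<in>B n. f a i \<in> D) \<and>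
    differing J (B n) (Field (cardSuc |D| )) f"
proof (rule ccontr)
  assume contr: "\<not> ?thesis"
  have infD: "infinite D"
    using D[of 0] beth_seq_infinite[OF B] card_of_ordLeq_finite by blast
  define S where "S n = {f :: 'a \<Rightarrow> 'b. \<forall>i\<in>B n. f i \<in> D}" for n
  define R where "R n J f g \<longleftrightarrow> {i \<in> B n. f i = g i} \<in> J" for n J and f g :: "'a \<Rightarrow> 'b"
  define max_fam where "max_fam n J M \<longleftrightarrow> M \<subseteq> S n \<and> (\<forall>f\<in>M. \<forall>g\<in>M. f \<noteq> g \<longrightarrow> R n J f g) \<and>
      (\<forall>f\<in>S n. f \<in> M \<or> (\<exists>g\<in>M. \<not> R n J f g))" for n J M
  define M where "M n J = (SOME M. max_fam n J M)" for n J
  have "R n J g f" if "R n J f g" for n J f g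
    using that unfolding R_def by (simp add: eq_commute)
  then have "\<exists>M. max_fam n J M" for n J
    unfolding max_fam_def by (rule maximal_pairwise)
  then have max_fam: "max_fam n J (M n J)" for n J
    unfolding M_def by (rule someI_ex)
  have M: "M n J \<subseteq> S n" for n J
    using max_fam unfolding max_fam_def by blast
  have M_diff: "R n J f g" if "f \<in> M n J" "g \<in> M n J" "f \<noteq> g" for n J f g
    using max_fam[of n J] that unfolding max_fam_def by blast
  have M_max: "f \<in> M n J \<or> (\<exists>g\<in>M n J. \<not> R n J f g)" if "f \<in> S n" for n J f
    using max_fam[of n J] that unfolding max_fam_def by blast
  have M_card: "|M n J| \<le>o |D|" if J: "sigma_ideal (B n) J" for n J
  proof (rule ccontr)
    assume "\<not> ?thesis"
    then obtain u where u: "inj_on u (Field (cardSuc |D| ))" "u ` Field (cardSuc |D| ) \<subseteq> M n J"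
      using card_of_ordLeq_Field_cardSuc by blast
    have "differing J (B n) (Field (cardSuc |D| )) u"
      unfolding differing_def
    proof (intro ballI impI)
      fix a b assume ab: "a \<in> Field (cardSuc |D| )" "b \<in> Field (cardSuc |D| )" "a \<noteq> b"
      then have "u a \<noteq> u b" "u a \<in> M n J" "u b \<in> M n J"
        using u by (auto dest: inj_onD)
      then show "{i \<in> B n. u a i = u b i} \<in> J"
        using M_diff unfolding R_def by blast
    qed
    moreover have "\<forall>a\<in>Field (cardSuc |D| ). \<forall>i\<in>B n. u a i \<in> D"
      using u(2) M unfolding S_def by blast
    ultimately show False using contr J by blast
  qed
  \<comment> \<open>All ideals on all \<open>B n\<close> are treated at once, because the ideal
    belonging to an uncovered set is known only after \<open>P\<close> is fixed. There are at most
    beth_(n+2) ideals on \<open>B n\<close>, so \<open>P\<close> has size at most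
    \<open>|D|\<close>.\<close>
  define P where "P = (\<Union>n. \<Union>J\<in>{J. sigma_ideal (B n) J}. (\<lambda>f. f ` B n) ` M n J)"
  have P1: "a \<subseteq> D \<and> small B a" if a: "a \<in> P" for a
  proof -
    obtain n J f where "a = f ` B n" "f \<in> M n J" using a unfolding P_def by auto
    then show ?thesis
      using M[of n J] card_of_image[of f "B n"] unfolding S_def small_def by blast
  qed
  have "|{J. sigma_ideal (B n) J}| \<le>o |D|" for n
  proof -
    have "{J. sigma_ideal (B n) J} \<subseteq> Pow (Pow (B n))"
      unfolding sigma_ideal_def by blast
    then have "|{J. sigma_ideal (B n) J}| \<le>o |Pow (Pow (B n))|" by (rule card_of_mono1)
    also have "|Pow (Pow (B n))| \<le>o |B (Suc (Suc n))|"
      by (rule beth_seq_Pow[OF B beth_seq_Pow[OF B card_of_mono1[OF subset_refl]]])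
    also have "|B (Suc (Suc n))| \<le>o |D|" by (rule D)
    finally show ?thesis .
  qed
  moreover have "|UNIV :: nat set| \<le>o |D|" using infD infinite_iff_card_of_nat by blast
  ultimately have P2: "|P| \<le>o |D|"
    unfolding P_def
    by (intro card_of_UNION_ordLeq_infinite[OF infD] ballI card_of_image_ordLeq M_card) simp_all
  have "covered B 0 D"
    if "\<forall>x\<subseteq>D. small B x \<longrightarrow> (\<exists>Q\<subseteq>P. |Q| \<le>o |B 0| \<and> x \<subseteq> \<Union>Q)"
    using that P1 P2 unfolding covered_def by (intro exI[of _ P]) simp
  then obtain x where x: "x \<subseteq> D" "small B x"
    and unc: "\<And>Q. Q \<subseteq> P \<Longrightarrow> |Q| \<le>o |B 0| \<Longrightarrow> \<not> x \<subseteq> \<Union>Q"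
    using nc by metis
  have "x \<noteq> {}" using unc[OF empty_subsetI card_of_empty] by auto
  obtain n where n: "|x| \<le>o |B n|" using x(2) unfolding small_def by metis
  then obtain f where f: "f ` B n = x" using card_of_ordLeq2[OF \<open>x \<noteq> {}\<close>] by metis
  \<comment> \<open>Countable subfamilies of \<open>P\<close> are closed under countable unions,
    \<open>B 0\<close> being countable, so this is a sigma-ideal; it is proper since
    \<open>x\<close> is uncovered.\<close>
  define J where "J = {y. y \<subseteq> B n \<and> (\<exists>Q\<subseteq>P. |Q| \<le>o |B 0| \<and> f ` y \<subseteq> \<Union>Q)}"
  have J: "sigma_ideal (B n) J"
    unfolding sigma_ideal_def
  proof (intro conjI allI impI)
    show "J \<subseteq> Pow (B n)" unfolding J_def by blast
    show "B n \<notin> J" using unc unfolding J_def mem_Collect_eq f by metis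
    show "\<forall>X\<in>J. \<forall>Y\<subseteq>X. Y \<in> J"
      unfolding J_def mem_Collect_eq Ball_def by (metis image_mono subset_trans)
    show "{} \<in> J"
      unfolding J_def mem_Collect_eq by (metis card_of_empty empty_subsetI image_empty)
  next
    fix A :: "nat \<Rightarrow> 'a set" assume "\<forall>n. A n \<in> J"
    then have A: "A k \<subseteq> B n" and "\<exists>Q\<subseteq>P. |Q| \<le>o |B 0| \<and> f ` A k \<subseteq> \<Union>Q" for k
      unfolding J_def by auto
    then obtain Q where QP: "\<And>k. Q k \<subseteq> P" and Qc: "\<And>k. |Q k| \<le>o |B 0|"
      and Qf: "\<And>k. f ` A k \<subseteq> \<Union>(Q k)"
      by metis
    have "|\<Union>k. Q k| \<le>o |B 0|"
      using Qc beth_seq_nat[OF B] beth_seq_infinite[OF B]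
      by (intro card_of_UNION_ordLeq_infinite) auto
    moreover have "(\<Union>k. Q k) \<subseteq> P" using QP by (rule UN_least)
    moreover have "f ` (\<Union>k. A k) \<subseteq> \<Union>(\<Union>k. Q k)" using Qf by fastforce
    moreover have "(\<Union>k. A k) \<subseteq> B n" using A by (rule UN_least)
    ultimately show "(\<Union>k. A k) \<in> J" unfolding J_def mem_Collect_eq by metis
  qed
  have fS: "f \<in> S n" using f x(1) unfolding S_def by auto
  have in_J: "y \<in> J" if "y \<subseteq> B n" "f ` y \<subseteq> a" "a \<in> P" for y a
  proof -
    have "B 0 \<noteq> {}" using beth_seq_infinite[OF B, of 0] by auto
    then have "|{a}| \<le>o |B 0|" by (rule card_of_singl_ordLeq)
    moreover have "{a} \<subseteq> P" "f ` y \<subseteq> \<Union>{a}" using that by simp_all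
    ultimately show ?thesis using that(1) unfolding J_def mem_Collect_eq by metis
  qed
  have notJ: "\<exists>g\<in>M n J. {i \<in> B n. f i = g i} \<notin> J"
  proof (cases "f \<in> M n J")
    case True
    then show ?thesis
      using J unfolding sigma_ideal_def by (intro bexI[of _ f]) simp_all
  next
    case False
    then show ?thesis using M_max[OF fS, of J] unfolding R_def by blast
  qed
  then obtain g where g: "g \<in> M n J" "{i \<in> B n. f i = g i} \<notin> J" by blast
  have "g ` B n \<in> P" using g(1) J unfolding P_def by blast
  then show False using in_J[of "{i \<in> B n. f i = g i}" "g ` B n"] g(2) by auto
qed

section \<open>Minimal bounds of large differing families\<close>

definition large_below ::
  "'a rel \<Rightarrow> 'b set set \<Rightarrow> 'g set \<Rightarrow> 'b set \<Rightarrow> ('b \<Rightarrow> 'a) \<Rightarrow> bool" where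
  "large_below r J G Y h \<longleftrightarrow>
     (\<exists>f. (\<forall>a\<in>G. \<forall>i\<in>Y. f a i \<in> underS r (h i)) \<and> differing J Y G f)"

text \<open>Along an infinite descent the discarded sets \<open>I - Y (Suc n)\<close> have a union
  in \<open>J\<close>, which is not \<open>I\<close>; at a surviving \<open>i\<close> the values
  \<open>h n i\<close> would descend forever in \<open>r\<close>.\<close>

lemma wf_pointwise_below:
  assumes r: "Well_order r" and J: "sigma_ideal I J"
  shows "wf {((Y', h'), (Y, h)). Y' \<subseteq> Y \<and> I - Y' \<in> J \<and> (\<forall>i\<in>Y'. h' i \<in> underS r (h i))}"
    (is "wf ?R")
  unfolding wf_iff_no_infinite_down_chain
proof
  assume "\<exists>c. \<forall>n. (c (Suc n), c n) \<in> ?R"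
  then obtain c where "\<forall>n. (c (Suc n), c n) \<in> ?R" by (rule exE)
  then have c: "(c (Suc n), c n) \<in> ?R" for n by (rule spec)
  define Y where "Y n = fst (c n)" for n
  define h where "h n = snd (c n)" for n
  have Y: "I - Y (Suc n) \<in> J" and h: "\<And>i. i \<in> Y (Suc n) \<Longrightarrow> h (Suc n) i \<in> underS r (h n i)" for n
    using c[of n] unfolding Y_def h_def by (auto split: prod.splits)
  have "(\<Union>n. I - Y (Suc n)) \<in> J" using J Y by (rule sigma_ideal_UN)
  then have "(\<Union>n. I - Y (Suc n)) \<noteq> I" using J unfolding sigma_ideal_def by metis
  then obtain i where i: "\<And>n. i \<in> Y (Suc n)" by auto
  have "(h (Suc n) i, h n i) \<in> r - Id" for n
    using h[OF i, of n] unfolding underS_def by simp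
  then have "\<exists>g. \<forall>n. (g (Suc n), g n) \<in> r - Id" by (intro exI[of _ "\<lambda>n. h n i"]) simp
  moreover have "wf (r - Id)" using r unfolding well_order_on_def by simp
  ultimately show False unfolding wf_iff_no_infinite_down_chain by simp
qed

text \<open>Well-foundedness gives a pair \<open>(Y, h)\<close> minimal among the large bounds on
  sets with complement in \<open>J\<close>. Then \<open>Y\<close> and the trace of \<open>J\<close>
  on it replace \<open>I\<close> and \<open>J\<close>.\<close>

lemma exists_minimal_large_below:
  assumes r: "Well_order r" and J: "sigma_ideal I J" and d: "d \<in> Field r"
    and large: "large_below r J G I (\<lambda>i. d)"
  shows "\<exists>Y\<subseteq>I. \<exists>K h. sigma_ideal Y K \<and> (\<forall>i\<in>Y. (h i, d) \<in> r) \<and> large_below r K G Y h \<and>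
    (\<forall>N\<in>K. \<forall>h'. (\<forall>i\<in>Y - N. h' i \<in> underS r (h i)) \<longrightarrow> \<not> large_below r K G (Y - N) h')"
proof -
  define S where "S = {(Y, h). Y \<subseteq> I \<and> I - Y \<in> J \<and> (\<forall>i\<in>Y. (h i, d) \<in> r) \<and> large_below r J G Y h}"
  have refl: "Refl r" and trans: "trans r"
    using r unfolding order_on_defs by simp_all
  have "{} \<in> J" using J unfolding sigma_ideal_def by simp
  then have "(I, \<lambda>i. d) \<in> S"
    using large refl_onD[OF refl d] unfolding S_def by simp
  then obtain z where z: "z \<in> S" and min: "\<And>y. (y, z) \<in>
      {((Y', h'), (Y, h)). Y' \<subseteq> Y \<and> I - Y' \<in> J \<and> (\<forall>i\<in>Y'. h' i \<in> underS r (h i))} \<Longrightarrow> y \<notin> S"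
    by (rule wfE_min[OF wf_pointwise_below[OF r J]]) simp
  obtain Y h where "z = (Y, h)" by (rule prod.exhaust)
  note YhS = z[unfolded this] and min = min[unfolded this]
  from YhS have Y: "Y \<subseteq> I" "I - Y \<in> J" and h: "\<And>i. i \<in> Y \<Longrightarrow> (h i, d) \<in> r"
    and Yh: "large_below r J G Y h" unfolding S_def by auto
  \<comment> \<open>The trace of \<open>J\<close> on \<open>Y\<close>. Agreement sets of functions
    on subsets of \<open>Y\<close> lie in \<open>Y\<close> anyway, so largeness means the same for
    \<open>J\<close> and \<open>K\<close>.\<close>
  define K where "K = {X \<in> J. X \<subseteq> Y}"
  have K_iff: "large_below r K G X h' \<longleftrightarrow> large_below r J G X h'" if "X \<subseteq> Y" for X h'
  proof -
    have "{i \<in> X. f a i = f b i} \<subseteq> Y" for f :: "'c \<Rightarrow> 'b \<Rightarrow> 'a" and a b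
      using that by blast
    then show ?thesis unfolding large_below_def differing_def K_def by simp
  qed
  have K: "sigma_ideal Y K"
    unfolding sigma_ideal_def
  proof (intro conjI)
    show "Y \<notin> K"
    proof
      assume "Y \<in> K"
      then have "Y \<in> J" unfolding K_def by simp
      then have "Y \<union> (I - Y) \<in> J" by (rule sigma_ideal_Un[OF J _ Y(2)])
      moreover have "Y \<union> (I - Y) = I" using Y(1) by auto
      ultimately show False using J unfolding sigma_ideal_def by simp
    qed
    show "\<forall>X\<in>K. \<forall>Y\<subseteq>X. Y \<in> K"
      using sigma_ideal_subset[OF J] unfolding K_def by (simp, metis subset_trans)
    show "\<forall>A::nat \<Rightarrow> 'b set. (\<forall>n. A n \<in> K) \<longrightarrow> (\<Union>n. A n) \<in> K"
      using sigma_ideal_UN[OF J] unfolding K_def by (simp add: UN_least)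
  qed (use \<open>{} \<in> J\<close> in \<open>auto simp: K_def\<close>)
  have "\<not> large_below r K G (Y - N) h'"
    if N: "N \<in> K" and h': "\<And>i. i \<in> Y - N \<Longrightarrow> h' i \<in> underS r (h i)" for N h'
  proof
    assume "large_below r K G (Y - N) h'"
    then have "large_below r J G (Y - N) h'" using K_iff[of "Y - N"] by simp
    moreover have "I - (Y - N) \<in> J"
      using sigma_ideal_subset[OF J sigma_ideal_Un[OF J Y(2), of N]] N
      unfolding K_def by auto
    moreover have "(h' i, d) \<in> r" if "i \<in> Y - N" for i
      using h'[OF that] h[of i] that transD[OF trans] unfolding underS_def by auto
    ultimately have "(Y - N, h') \<in> S" using Y(1) unfolding S_def by auto
    then show False using min[of "(Y - N, h')"] \<open>I - (Y - N) \<in> J\<close> h' by auto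
  qed
  with K h K_iff[of Y h] Yh Y(1) show ?thesis by (intro exI[of _ Y] exI[of _ K] exI[of _ h] conjI) auto
qed

section \<open>The ideal of a minimal bound, and domination modulo it\<close>

locale minimal_family =
  fixes r :: "'a rel" and I :: "'b set" and J :: "'b set set" and D :: "'d set"
    and h :: "'b \<Rightarrow> 'a" and f :: "'d set \<Rightarrow> 'b \<Rightarrow> 'a"
  assumes wo: "Well_order r" and J: "sigma_ideal I J"
    and D: "infinite D" and PowI: "|Pow I| \<le>o |D|"
    and f: "\<And>a i. a \<in> Field (cardSuc |D| ) \<Longrightarrow> i \<in> I \<Longrightarrow> f a i \<in> underS r (h i)"
    and diff: "differing J I (Field (cardSuc |D| )) f"
    and minimal: "\<And>N h'. N \<in> J \<Longrightarrow> (\<And>i. i \<in> I - N \<Longrightarrow> h' i \<in> underS r (h i)) \<Longrightarrow>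
      \<not> large_below r J (Field (cardSuc |D| )) (I - N) h'"
begin

text \<open>A set of size \<open>|D|^+\<close>; the successor cardinal is realized on the type of
  sets over that of \<open>D\<close>, hence the type of the index of \<open>f\<close>.\<close>

abbreviation "G \<equiv> Field (cardSuc |D| )"

text \<open>
  \<open>K\<close> collects the sets on which \<open>h\<close> can be decreased. Shrinking to smaller and smaller positive sets
  to decrease \<open>h\<close> need not terminate, as their intersection may be empty; passing to \<open>K\<close> instead makes
  \<open>h\<close> minimal on all positive sets at once.
\<close>

definition K :: "'b set set" where
  "K = {X. X \<subseteq> I \<and>
     (\<exists>N\<in>J. \<exists>h'. (\<forall>i\<in>X - N. h' i \<in> underS r (h i)) \<and> large_below r J G (X - N) h')}"

lemma empty_in_J: "{} \<in> J"
  using J unfolding sigma_ideal_def by simp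

lemma KI:
  assumes "X \<subseteq> I" "N \<in> J" and "\<And>i. i \<in> X - N \<Longrightarrow> h' i \<in> underS r (h i)"
    and "\<And>a i. a \<in> G \<Longrightarrow> i \<in> X - N \<Longrightarrow> g a i \<in> underS r (h' i)" "differing J (X - N) G g"
  shows "X \<in> K"
  unfolding K_def large_below_def mem_Collect_eq
  by (intro conjI bexI[OF _ assms(2)] exI[of _ h'] exI[of _ g]) (use assms in auto)

lemma KE:
  assumes "X \<in> K"
  shows "\<exists>N h' g. N \<in> J \<and> (\<forall>i\<in>X - N. h' i \<in> underS r (h i)) \<and>
    (\<forall>a\<in>G. \<forall>i\<in>X - N. g a i \<in> underS r (h' i)) \<and> differing J (X - N) G g"
  using assms unfolding K_def large_below_def mem_Collect_eq by metis

lemma K_subset: "X \<in> K \<Longrightarrow> X \<subseteq> I"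
  unfolding K_def by simp

lemma J_subset_K: "J \<subseteq> K"
proof
  fix X assume X: "X \<in> J"
  then have "X \<subseteq> I" using J unfolding sigma_ideal_def by auto
  then show "X \<in> K" using X empty_in_J by (intro KI[of X X]) (auto simp: differing_def)
qed

lemma differing_subset:
  assumes "differing J X G' g" "Y \<subseteq> X"
  shows "differing J Y G' g"
  unfolding differing_def
proof (intro ballI impI)
  fix a b assume "a \<in> G'" "b \<in> G'" "a \<noteq> b"
  then have "{i \<in> X. g a i = g b i} \<in> J" using assms(1) unfolding differing_def by simp
  moreover have "{i \<in> Y. g a i = g b i} \<subseteq> {i \<in> X. g a i = g b i}" using assms(2) by auto
  ultimately show "{i \<in> Y. g a i = g b i} \<in> J" by (rule sigma_ideal_subset[OF J])
qed

text \<open>Properness is the minimality of \<open>h\<close>. For countable unions, bounds and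
  families are glued, using at \<open>i\<close> the data of the first \<open>A n\<close> containing
  \<open>i\<close>; two glued functions agree only inside the union of countably many agreement sets
  in \<open>J\<close>.\<close>

lemma K: "sigma_ideal I K"
  unfolding sigma_ideal_def
proof (intro conjI allI impI ballI)
  show "K \<subseteq> Pow I" unfolding K_def by auto
  show "I \<notin> K"
  proof
    assume "I \<in> K"
    then obtain N h' where "N \<in> J" "\<forall>i\<in>I - N. h' i \<in> underS r (h i)"
      "large_below r J G (I - N) h'"
      unfolding K_def mem_Collect_eq by metis
    then show False using minimal by metis
  qed
  show "{} \<in> K" using empty_in_J J_subset_K by auto
next
  fix X Y assume X: "X \<in> K" and Y: "Y \<subseteq> X"
  then obtain N h' g where N: "N \<in> J" and h': "\<And>i. i \<in> X - N \<Longrightarrow> h' i \<in> underS r (h i)"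
    and g: "\<And>a i. a \<in> G \<Longrightarrow> i \<in> X - N \<Longrightarrow> g a i \<in> underS r (h' i)"
    and gd: "differing J (X - N) G g"
    using KE by metis
  have sub: "Y - N \<subseteq> X - N" using Y by auto
  show "Y \<in> K"
    using subset_trans[OF Y K_subset[OF X]] N
    by (rule KI) (use h' g sub differing_subset[OF gd sub] in auto)
next
  fix A :: "nat \<Rightarrow> 'b set" assume A: "\<forall>n. A n \<in> K"
  then have "\<forall>n. \<exists>N h' g. N \<in> J \<and> (\<forall>i\<in>A n - N. h' i \<in> underS r (h i)) \<and>
      (\<forall>a\<in>G. \<forall>i\<in>A n - N. g a i \<in> underS r (h' i)) \<and> differing J (A n - N) G g"
    by (intro allI KE) simp
  then obtain N h' g where Nhg: "\<And>n. N n \<in> J \<and> (\<forall>i\<in>A n - N n. h' n i \<in> underS r (h i)) \<and>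
      (\<forall>a\<in>G. \<forall>i\<in>A n - N n. g n a i \<in> underS r (h' n i)) \<and> differing J (A n - N n) G (g n)"
    unfolding choice_iff by auto
  define m where "m i = (LEAST n. i \<in> A n)" for i
  let ?N = "\<Union>n. N n" and ?A = "\<Union>n. A n"
  have mA: "i \<in> A (m i) - N (m i)" if "i \<in> ?A - ?N" for i
    using that unfolding m_def by (auto intro: LeastI)
  have dm: "differing J (?A - ?N) G (\<lambda>a i. g (m i) a i)"
    unfolding differing_def
  proof (intro ballI impI)
    fix a b assume ab: "a \<in> G" "b \<in> G" "a \<noteq> b"
    have "(\<Union>n. {i \<in> A n - N n. g n a i = g n b i}) \<in> J"
      using Nhg ab by (intro sigma_ideal_UN[OF J]) (simp add: differing_def)
    moreover have "{i \<in> ?A - ?N. g (m i) a i = g (m i) b i} \<subseteq>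
        (\<Union>n. {i \<in> A n - N n. g n a i = g n b i})"
      using mA by fastforce
    ultimately show "{i \<in> ?A - ?N. g (m i) a i = g (m i) b i} \<in> J" by (rule sigma_ideal_subset[OF J])
  qed
  have "?N \<in> J" using Nhg by (intro sigma_ideal_UN[OF J]) simp
  moreover have "?A \<subseteq> I" using A K_subset by (intro UN_least) simp
  moreover have "h' (m i) i \<in> underS r (h i)" if "i \<in> ?A - ?N" for i
    using Nhg mA[OF that] by metis
  moreover have "g (m i) a i \<in> underS r (h' (m i) i)" if "a \<in> G" "i \<in> ?A - ?N" for a i
    using Nhg mA[OF that(2)] that(1) by metis
  ultimately show "?A \<in> K" using dm by (intro KI[of ?A ?N "\<lambda>i. h' (m i) i"]) auto
qed

lemma in_K:
  assumes "Y \<subseteq> I" "\<And>i. i \<in> Y \<Longrightarrow> g i \<in> underS r (h i)"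
    and "\<And>a i. a \<in> G \<Longrightarrow> i \<in> Y \<Longrightarrow> F a i \<in> underS r (g i)" "differing J Y G F"
  shows "Y \<in> K"
  by (rule KI[of Y "{}" g F]) (use assms empty_in_J in auto)

text \<open>Coding each \<open>T i\<close> injectively into the ordinal \<open>g i\<close> preserves
  agreement sets, so \<open>|D|^+\<close> functions in \<open>S\<close> would form a large family
  below \<open>g < h\<close> on \<open>Y\<close>, forcing \<open>Y \<in> K\<close>.\<close>

lemma differing_bounded:
  assumes Y: "Y \<subseteq> I" "Y \<notin> K" and g: "\<And>i. i \<in> Y \<Longrightarrow> g i \<in> underS r (h i)"
    and T: "\<And>i. i \<in> Y \<Longrightarrow> |T i| \<le>o |underS r (g i)|"
    and S: "\<And>a i. a \<in> S \<Longrightarrow> i \<in> Y \<Longrightarrow> a i \<in> T i"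
    and dS: "\<And>a b. a \<in> S \<Longrightarrow> b \<in> S \<Longrightarrow> a \<noteq> b \<Longrightarrow> {i \<in> Y. a i = b i} \<in> J"
  shows "|S| \<le>o |D|"
proof (rule ccontr)
  assume "\<not> ?thesis"
  then obtain u where u: "inj_on u G" "u ` G \<subseteq> S" using card_of_ordLeq_Field_cardSuc by metis
  have "\<exists>c. inj_on c (T i) \<and> c ` T i \<subseteq> underS r (g i)" if "i \<in> Y" for i
    using T[OF that] card_of_ordLeq by metis
  then obtain c where c: "\<And>i. i \<in> Y \<Longrightarrow> inj_on (c i) (T i)"
    and cT: "\<And>i. i \<in> Y \<Longrightarrow> c i ` T i \<subseteq> underS r (g i)"
    by metis
  have uS: "u a \<in> S" if "a \<in> G" for a using u(2) that by auto
  have "differing J Y G (\<lambda>a i. c i (u a i))"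
    unfolding differing_def
  proof (intro ballI impI)
    fix a b assume ab: "a \<in> G" "b \<in> G" "a \<noteq> b"
    have "{i \<in> Y. c i (u a i) = c i (u b i)} = {i \<in> Y. u a i = u b i}"
      using c S[OF uS] ab(1,2) by (auto dest: inj_onD)
    then show "{i \<in> Y. c i (u a i) = c i (u b i)} \<in> J"
      using dS[OF uS uS] ab inj_onD[OF u(1)] by metis
  qed
  moreover have "c i (u a i) \<in> underS r (g i)" if "a \<in> G" "i \<in> Y" for a i
    using cT[OF that(2)] S[OF uS[OF that(1)] that(2)] by auto
  ultimately have "Y \<in> K"
    by (intro in_K[where g = g and F = "\<lambda>a i. c i (u a i)"]) (use Y g in auto)
  then show False using Y by simp
qed

text \<open>If \<open>f b\<close> is not below \<open>f c\<close> modulo \<open>K\<close> and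
  \<open>c \<noteq> b\<close>, then \<open>f c < f b\<close> on a \<open>K\<close>-positive set
  \<open>Y\<close>, equality being confined to a set in \<open>J\<close>. For each \<open>Y\<close>
  there are at most \<open>|D|\<close> such \<open>c\<close>, since more would give a large family
  below \<open>f b < h\<close> on \<open>Y\<close>. With at most \<open>|D|\<close> choices of
  \<open>b\<close> and \<open>Y\<close>, some index in \<open>G\<close> avoids all
  exceptions.\<close>

lemma dominated:
  assumes E: "E \<subseteq> G" "|E| \<le>o |D|"
  shows "\<exists>c\<in>G. \<forall>b\<in>E. {i \<in> I. f b i \<notin> underS r (f c i)} \<in> K"
proof -
  define M where "M b = {c \<in> G. {i \<in> I. f b i \<notin> underS r (f c i)} \<notin> K}" for b
  have M: "|M b| \<le>o |D|" if b: "b \<in> G" for b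
  proof -
    define L where "L Y = {c \<in> G. {i \<in> I. f c i \<in> underS r (f b i)} = Y}" for Y
    have L: "|L Y| \<le>o |D|" if Y: "Y \<in> Pow I - K" for Y
    proof (rule ccontr)
      assume "\<not> ?thesis"
      then obtain u where u: "inj_on u G" "u ` G \<subseteq> L Y" using card_of_ordLeq_Field_cardSuc by metis
      have "differing J Y G (\<lambda>a. f (u a))"
        unfolding differing_def
      proof (intro ballI impI)
        fix a b assume ab: "a \<in> G" "b \<in> G" "a \<noteq> b"
        then have "u a \<noteq> u b" "u a \<in> G" "u b \<in> G" using u unfolding L_def by (auto dest: inj_onD)
        then have "{i \<in> I. f (u a) i = f (u b) i} \<in> J" using diff unfolding differing_def by simp
        then show "{i \<in> Y. f (u a) i = f (u b) i} \<in> J"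
          by (rule sigma_ideal_subset[OF J]) (use Y in auto)
      qed
      moreover have "f (u a) i \<in> underS r (f b i)" if "a \<in> G" "i \<in> Y" for a i
        using u(2) that unfolding L_def by auto
      ultimately have "Y \<in> K"
        by (intro in_K[where g = "f b" and F = "\<lambda>a. f (u a)"]) (use Y f[OF b] in auto)
      then show False using Y by simp
    qed
    \<comment> \<open>\<open>b\<close> itself is an exception, as \<open>f b\<close> is nowhere
      below itself; the others are sorted by the positive set on which they lie below
      \<open>f b\<close>.\<close>
    have "M b \<subseteq> insert b (\<Union>Y\<in>Pow I - K. L Y)"
    proof
      fix c assume c: "c \<in> M b"
      show "c \<in> insert b (\<Union>Y\<in>Pow I - K. L Y)"
      proof (cases "c = b")
        case False
        have cG: "c \<in> G" using c unfolding M_def by simp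
        let ?Y = "{i \<in> I. f c i \<in> underS r (f b i)}"
        have "?Y \<notin> K"
        proof
          assume "?Y \<in> K"
          moreover have "{i \<in> I. f c i = f b i} \<in> K"
            using diff cG b False J_subset_K unfolding differing_def by auto
          ultimately have "?Y \<union> {i \<in> I. f c i = f b i} \<in> K" by (rule sigma_ideal_Un[OF K])
          moreover have "{i \<in> I. f b i \<notin> underS r (f c i)} \<subseteq> ?Y \<union> {i \<in> I. f c i = f b i}"
          proof
            fix i assume i: "i \<in> {i \<in> I. f b i \<notin> underS r (f c i)}"
            then have "f b i \<in> Field r" "f c i \<in> Field r"
              using f[OF b, of i] f[OF cG, of i] unfolding underS_def Field_def by auto
            moreover have "total_on (Field r) r" using wo unfolding order_on_defs by simp
            ultimately show "i \<in> ?Y \<union> {i \<in> I. f c i = f b i}"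
              using i unfolding underS_def total_on_def by auto
          qed
          ultimately have "{i \<in> I. f b i \<notin> underS r (f c i)} \<in> K"
            by (rule sigma_ideal_subset[OF K])
          then show False using c unfolding M_def by simp
        qed
        moreover have "c \<in> L ?Y" using cG unfolding L_def by simp
        ultimately show ?thesis by auto
      qed simp
    qed
    then have sub: "M b \<subseteq> {b} \<union> (\<Union>Y\<in>Pow I - K. L Y)" by simp
    have "|Pow I - K| \<le>o |D|"
      using card_of_mono1[OF Diff_subset] PowI ordLeq_transitive by metis
    then have "|\<Union>Y\<in>Pow I - K. L Y| \<le>o |D|"
      using L by (intro card_of_UNION_ordLeq_infinite[OF D]) auto
    moreover have "|{b}| \<le>o |D|" using D by (intro card_of_singl_ordLeq) auto
    ultimately have "|{b} \<union> (\<Union>Y\<in>Pow I - K. L Y)| \<le>o |D|"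
      using D card_of_Un_ordLeq_infinite_Field[of "|D|"]
      unfolding Field_card_of by (metis card_of_card_order_on)
    then show ?thesis using card_of_mono1[OF sub] ordLeq_transitive by metis
  qed
  have "|\<Union>b\<in>E. M b| \<le>o |D|"
    using M E by (intro card_of_UNION_ordLeq_infinite[OF D]) auto
  then have "\<not> G \<subseteq> (\<Union>b\<in>E. M b)"
    using Field_cardSuc_not_ordLeq card_of_mono1 ordLeq_transitive by metis
  then show ?thesis unfolding M_def by auto
qed

text \<open>Applied with \<open>T i\<close> a covering family of the ordinal \<open>g i\<close>: up
  to agreement on a \<open>J\<close>-positive set, at most \<open>|D|\<close> choice functions of
  \<open>T\<close> on \<open>Y\<close> matter. Positivity of \<open>Y\<close> modulo
  \<open>K\<close> bounds the maximal differing family.\<close>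

lemma small_maximal_family:
  assumes Y: "Y \<subseteq> I" "Y \<notin> K" and g: "\<And>i. i \<in> Y \<Longrightarrow> g i \<in> underS r (h i)"
    and T: "\<And>i. i \<in> Y \<Longrightarrow> |T i| \<le>o |underS r (g i)|"
  shows "\<exists>M. |M| \<le>o |D| \<and> (\<forall>a\<in>M. \<forall>i\<in>Y. a i \<in> T i) \<and>
    (\<forall>a. (\<forall>i\<in>Y. a i \<in> T i) \<longrightarrow> (\<exists>b\<in>M. {i \<in> Y. a i = b i} \<notin> J))"
proof -
  let ?S = "{a. \<forall>i\<in>Y. a i \<in> T i}"
  have "\<exists>M\<subseteq>?S. (\<forall>a\<in>M. \<forall>b\<in>M. a \<noteq> b \<longrightarrow> {i \<in> Y. a i = b i} \<in> J) \<and>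
      (\<forall>a\<in>?S. a \<in> M \<or> (\<exists>b\<in>M. {i \<in> Y. a i = b i} \<notin> J))"
    by (rule maximal_pairwise) (simp add: eq_commute)
  then obtain M where M: "M \<subseteq> ?S" and Md: "\<forall>a\<in>M. \<forall>b\<in>M. a \<noteq> b \<longrightarrow> {i \<in> Y. a i = b i} \<in> J"
    and max: "\<forall>a\<in>?S. a \<in> M \<or> (\<exists>b\<in>M. {i \<in> Y. a i = b i} \<notin> J)"
    by (elim exE conjE)
  have "|M| \<le>o |D|"
    by (rule differing_bounded[OF Y g T]) (use M Md in auto)
  moreover have "\<exists>b\<in>M. {i \<in> Y. a i = b i} \<notin> J" if "\<forall>i\<in>Y. a i \<in> T i" for a
  proof (cases "a \<in> M")
    case True
    have "{i \<in> Y. a i = a i} \<notin> J" using Y(2) J_subset_K by auto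
    then show ?thesis using True by (rule bexI)
  next
    case False
    moreover have "a \<in> ?S" using that by simp
    ultimately show ?thesis using bspec[OF max, of a] by simp
  qed
  ultimately show ?thesis using M by (intro exI[of _ M]) auto
qed

text \<open>Each \<open>b\<close> in \<open>D\<close> is coded by \<open>f (e b)\<close>, and all
  codes lie below one \<open>g < h\<close> modulo \<open>K\<close>. Selecting members of the
  covering families \<open>T i\<close> on a positive set yields a block: the \<open>b\<close> whose
  codes lie in the selected sets. Blocks of selections from maximal families form \<open>P\<close>.
  A small \<open>x\<close> needs only selections from sets \<open>Q i\<close> of at most beth_n
  members covering the values of its codes at \<open>i\<close>.\<close>

lemma covered_step:
  fixes B :: "nat \<Rightarrow> 'c set"
  assumes B: "beth_seq B" and I: "|I| \<le>o |B nI|"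
    and IH: "\<And>i g. i \<in> I \<Longrightarrow> g \<in> underS r (h i) \<Longrightarrow> underS r g \<noteq> {} \<Longrightarrow> \<exists>n. covered B n (underS r g)"
  shows "\<exists>n. covered B n D"
proof -
  have "|D| \<le>o |G|"
    using not_ordLeq_card Field_cardSuc_not_ordLeq ordLess_imp_ordLeq by metis
  then obtain e where e: "inj_on e D" "e ` D \<subseteq> G" using card_of_ordLeq by metis
  have eG: "e b \<in> G" if "b \<in> D" for b using e(2) that by auto
  obtain c where c: "c \<in> G" and cK: "\<And>b. b \<in> D \<Longrightarrow> {i \<in> I. f (e b) i \<notin> underS r (f c i)} \<in> K"
    using dominated[OF e(2) card_of_image] by auto
  define g where "g = f c"
  have g: "g i \<in> underS r (h i)" if "i \<in> I" for i
    using f[OF c that] unfolding g_def .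
  have gK: "{i \<in> I. f (e b) i \<notin> underS r (g i)} \<in> K" if "b \<in> D" for b
    using cK[OF that] unfolding g_def .
  \<comment> \<open>The code of one element witnesses that \<open>underS r (g i)\<close> is nonempty
    for all \<open>i\<close> off a set in \<open>K\<close>, as the induction hypothesis
    requires.\<close>
  obtain b0 where b0: "b0 \<in> D" using D by fastforce
  have "\<exists>n. {i \<in> I. covered B n (underS r (g i))} \<notin> K"
  proof (rule ccontr)
    assume "\<not> ?thesis"
    then have "(\<Union>n. {i \<in> I. covered B n (underS r (g i))}) \<in> K"
      by (intro sigma_ideal_UN[OF K]) simp
    then have "(\<Union>n. {i \<in> I. covered B n (underS r (g i))}) \<union>
        {i \<in> I. f (e b0) i \<notin> underS r (g i)} \<in> K"
      using gK[OF b0] by (rule sigma_ideal_Un[OF K])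
    moreover have "I \<subseteq> (\<Union>n. {i \<in> I. covered B n (underS r (g i))}) \<union>
        {i \<in> I. f (e b0) i \<notin> underS r (g i)}"
      using IH g by fastforce
    ultimately have "I \<in> K" by (rule sigma_ideal_subset[OF K])
    then show False using K unfolding sigma_ideal_def by simp
  qed
  then obtain n where n: "{i \<in> I. covered B n (underS r (g i))} \<notin> K" by (rule exE)
  define X where "X = {i \<in> I. covered B n (underS r (g i))}"
  have XI: "X \<subseteq> I" and XK: "X \<notin> K" using n unfolding X_def by auto
  have "\<forall>i\<in>X. \<exists>T. (\<forall>a\<in>T. small B a) \<and> |T| \<le>o |underS r (g i)| \<and>
      (\<forall>x\<subseteq>underS r (g i). small B x \<longrightarrow> (\<exists>Q\<subseteq>T. |Q| \<le>o |B n| \<and> x \<subseteq> \<Union>Q))"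
    unfolding X_def covered_def by (simp, metis)
  from bchoice[OF this] obtain T where "\<forall>i\<in>X. (\<forall>a\<in>T i. small B a) \<and> |T i| \<le>o |underS r (g i)| \<and>
      (\<forall>x\<subseteq>underS r (g i). small B x \<longrightarrow> (\<exists>Q\<subseteq>T i. |Q| \<le>o |B n| \<and> x \<subseteq> \<Union>Q))"
    by (rule exE)
  note T = bspec[OF this]
  define good where "good Y \<longleftrightarrow> Y \<subseteq> X \<and> Y \<notin> K" for Y
  have "\<forall>Y. \<exists>M. good Y \<longrightarrow> |M| \<le>o |D| \<and> (\<forall>a\<in>M. \<forall>i\<in>Y. a i \<in> T i) \<and>
      (\<forall>a. (\<forall>i\<in>Y. a i \<in> T i) \<longrightarrow> (\<exists>b\<in>M. {i \<in> Y. a i = b i} \<notin> J))"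
  proof
    fix Y
    show "\<exists>M. good Y \<longrightarrow> |M| \<le>o |D| \<and> (\<forall>a\<in>M. \<forall>i\<in>Y. a i \<in> T i) \<and>
      (\<forall>a. (\<forall>i\<in>Y. a i \<in> T i) \<longrightarrow> (\<exists>b\<in>M. {i \<in> Y. a i = b i} \<notin> J))"
    proof (cases "good Y")
      case True
      then have "Y \<subseteq> I" "Y \<notin> K" "\<And>i. i \<in> Y \<Longrightarrow> i \<in> X" using XI unfolding good_def by auto
      then have "\<exists>M. |M| \<le>o |D| \<and> (\<forall>a\<in>M. \<forall>i\<in>Y. a i \<in> T i) \<and>
          (\<forall>a. (\<forall>i\<in>Y. a i \<in> T i) \<longrightarrow> (\<exists>b\<in>M. {i \<in> Y. a i = b i} \<notin> J))"
        using T g by (intro small_maximal_family[where g = g]) auto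
      then show ?thesis by simp
    qed simp
  qed
  from choice[OF this] obtain M where
    "\<forall>Y. good Y \<longrightarrow> |M Y| \<le>o |D| \<and> (\<forall>a\<in>M Y. \<forall>i\<in>Y. a i \<in> T i) \<and>
      (\<forall>a. (\<forall>i\<in>Y. a i \<in> T i) \<longrightarrow> (\<exists>b\<in>M Y. {i \<in> Y. a i = b i} \<notin> J))"
    by (rule exE)
  note M0 = mp[OF spec[OF this]]
  have M: "|M Y| \<le>o |D|" and MT: "\<And>a i. a \<in> M Y \<Longrightarrow> i \<in> Y \<Longrightarrow> a i \<in> T i"
    and Mmax: "\<And>a. (\<And>i. i \<in> Y \<Longrightarrow> a i \<in> T i) \<Longrightarrow> \<exists>b\<in>M Y. {i \<in> Y. a i = b i} \<notin> J"
    if "good Y" for Y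
    using M0[OF that] by simp_all
  define blk where "blk a Z = {b \<in> D. \<forall>i\<in>Z. f (e b) i \<in> a i}" for a :: "'b \<Rightarrow> 'a set" and Z
  \<comment> \<open>Restricting \<open>a\<close> to a \<open>J\<close>-positive \<open>Z\<close>
    allows one bound beth_l for all \<open>a i\<close>, which makes the block small; the number of
    pairs stays at most \<open>|D|\<close> because \<open>|Pow I|\<close> is.\<close>
  define Idx where "Idx = {(a, Z). a \<in> (\<Union>Y\<in>{Y. good Y}. M Y) \<and> Z \<subseteq> I \<and> Z \<notin> J \<and>
    (\<exists>l. \<forall>i\<in>Z. |a i| \<le>o |B l| )}"
  define P where "P = (\<lambda>(a, Z). blk a Z) ` Idx"
  have P_card: "|P| \<le>o |D|"
  proof -
    have "{Y. good Y} \<subseteq> Pow I" using XI unfolding good_def by auto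
    then have "|{Y. good Y}| \<le>o |D|" using card_of_mono1 PowI ordLeq_transitive by metis
    then have "|\<Union>Y\<in>{Y. good Y}. M Y| \<le>o |D|"
      using M by (intro card_of_UNION_ordLeq_infinite[OF D]) auto
    then have "|(\<Union>Y\<in>{Y. good Y}. M Y) \<times> Pow I| \<le>o |D|"
      using PowI by (intro card_of_Sigma_ordLeq_infinite[OF D]) auto
    moreover have "Idx \<subseteq> (\<Union>Y\<in>{Y. good Y}. M Y) \<times> Pow I" unfolding Idx_def by auto
    ultimately have "|Idx| \<le>o |D|" using card_of_mono1 ordLeq_transitive by metis
    then show ?thesis unfolding P_def by (rule card_of_image_ordLeq)
  qed
  have P_small: "a \<subseteq> D \<and> small B a" if a: "a \<in> P" for a
  proof -
    obtain a' Z where a_eq: "a = blk a' Z" and Idx: "(a', Z) \<in> Idx"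
      using a unfolding P_def by (rule imageE) (metis case_prod_conv surj_pair)
    have Z: "Z \<subseteq> I" "Z \<notin> J" and "\<exists>l. \<forall>i\<in>Z. |a' i| \<le>o |B l|"
      using Idx unfolding Idx_def by simp_all
    then obtain l where l: "\<And>i. i \<in> Z \<Longrightarrow> |a' i| \<le>o |B l|" by metis
    \<comment> \<open>Codes of different elements agree only on a set in \<open>J\<close>, and
      \<open>Z \<notin> J\<close>, so the graph over \<open>Z\<close> determines the element; these
      graphs are subsets of \<open>Sigma Z a'\<close>.\<close>
    define gr where "gr b = (\<lambda>i. (i, f (e b) i)) ` Z" for b
    have "inj_on gr a"
    proof (rule inj_onI, rule ccontr)
      fix x y assume xy: "x \<in> a" "y \<in> a" "gr x = gr y" "x \<noteq> y"
      have "f (e x) i = f (e y) i" if "i \<in> Z" for i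
      proof -
        have "(i, f (e x) i) \<in> gr y" using that xy(3) unfolding gr_def by auto
        then show ?thesis unfolding gr_def by auto
      qed
      then have "Z \<subseteq> {i \<in> I. f (e x) i = f (e y) i}" using Z(1) by auto
      moreover have "x \<in> D" "y \<in> D" using xy(1,2) unfolding a_eq blk_def by auto
      then have "{i \<in> I. f (e x) i = f (e y) i} \<in> J"
        using diff eG xy(4) inj_onD[OF e(1)] unfolding differing_def by metis
      ultimately show False using Z(2) sigma_ideal_subset[OF J] by metis
    qed
    moreover have "gr ` a \<subseteq> Pow (Sigma Z a')" unfolding gr_def a_eq blk_def by auto
    ultimately have "|a| \<le>o |Pow (Sigma Z a')|" using card_of_ordLeq by metis
    moreover have "|Z| \<le>o |B nI|" using card_of_mono1[OF Z(1)] I by (rule ordLeq_transitive)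
    then have "|Pow (Sigma Z a')| \<le>o |B (Suc (max nI l))|"
      using l by (intro beth_seq_Pow[OF B] beth_seq_Sigma[OF B])
    ultimately have "|a| \<le>o |B (Suc (max nI l))|" by (rule ordLeq_transitive)
    then show ?thesis unfolding small_def a_eq blk_def by auto
  qed
  have block: "\<exists>p\<in>P. \<forall>b\<in>D. (\<forall>i\<in>Y. f (e b) i \<in> q i) \<longrightarrow> b \<in> p"
    if Y: "good Y" and q: "\<And>i. i \<in> Y \<Longrightarrow> q i \<in> T i" for Y q
  proof -
    obtain a where a: "a \<in> M Y" "{i \<in> Y. q i = a i} \<notin> J" using Mmax[OF Y q] by (rule bexE)
    have aT: "a i \<in> T i" if "i \<in> Y" for i using MT[OF Y a(1) that] .
    have YX: "Y \<subseteq> X" using Y unfolding good_def by simp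
    \<comment> \<open>Each \<open>a i\<close> is bounded by some beth_l; by countable completeness
      one \<open>l\<close> works on a \<open>J\<close>-positive part of the agreement set.\<close>
    have "\<exists>l. {i \<in> Y. q i = a i \<and> |a i| \<le>o |B l| } \<notin> J"
    proof (rule ccontr)
      assume "\<not> ?thesis"
      then have "(\<Union>l. {i \<in> Y. q i = a i \<and> |a i| \<le>o |B l| }) \<in> J"
        by (intro sigma_ideal_UN[OF J]) simp
      moreover have "{i \<in> Y. q i = a i} \<subseteq> (\<Union>l. {i \<in> Y. q i = a i \<and> |a i| \<le>o |B l| })"
      proof
        fix i assume i: "i \<in> {i \<in> Y. q i = a i}"
        then have "small B (a i)" using T[of i] aT[of i] YX by auto
        then obtain l where "|a i| \<le>o |B l|" unfolding small_def by (rule exE)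
        then show "i \<in> (\<Union>l. {i \<in> Y. q i = a i \<and> |a i| \<le>o |B l| })" using i by auto
      qed
      ultimately have "{i \<in> Y. q i = a i} \<in> J" by (rule sigma_ideal_subset[OF J])
      then show False using a(2) by simp
    qed
    then obtain l where l: "{i \<in> Y. q i = a i \<and> |a i| \<le>o |B l| } \<notin> J" by (rule exE)
    define Z where "Z = {i \<in> Y. q i = a i \<and> |a i| \<le>o |B l| }"
    have "(a, Z) \<in> Idx"
      using l a(1) Y YX XI unfolding Idx_def Z_def by auto
    then have "blk a Z \<in> P" unfolding P_def by (intro image_eqI[of _ _ "(a, Z)"]) simp_all
    moreover have "b \<in> blk a Z" if "b \<in> D" "\<forall>i\<in>Y. f (e b) i \<in> q i" for b
      using that unfolding blk_def Z_def by auto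
    ultimately show ?thesis by (intro bexI[of _ "blk a Z"]) auto
  qed
  have cover: "\<exists>Q\<subseteq>P. |Q| \<le>o |B (Suc (max nI n))| \<and> x \<subseteq> \<Union>Q"
    if x: "x \<subseteq> D" "small B x" for x
  proof -
    define xi where "xi i = (\<lambda>b. f (e b) i) ` x \<inter> underS r (g i)" for i
    have "\<exists>Q\<subseteq>T i. |Q| \<le>o |B n| \<and> xi i \<subseteq> \<Union>Q" if i: "i \<in> X" for i
    proof -
      have "|xi i| \<le>o |x|"
        using card_of_mono1[OF Int_lower1] card_of_image ordLeq_transitive unfolding xi_def by metis
      then have "small B (xi i)" using x(2) ordLeq_transitive unfolding small_def by metis
      moreover have "xi i \<subseteq> underS r (g i)" unfolding xi_def by simp
      ultimately show ?thesis using T[OF i] by simp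
    qed
    then obtain Q where QT: "\<And>i. i \<in> X \<Longrightarrow> Q i \<subseteq> T i" and Qc: "\<And>i. i \<in> X \<Longrightarrow> |Q i| \<le>o |B n|"
      and Qx: "\<And>i. i \<in> X \<Longrightarrow> xi i \<subseteq> \<Union>(Q i)"
      by metis
    \<comment> \<open>The set where the code of \<open>b\<close> lies below \<open>g\<close> depends
      on \<open>b\<close>, which is why maximal families were chosen for every good
      \<open>Y\<close>.\<close>
    define Yb where "Yb b = {i \<in> X. f (e b) i \<in> underS r (g i)}" for b
    have Yb: "good (Yb b)" if "b \<in> D" for b
    proof -
      have "Yb b \<notin> K"
      proof
        assume "Yb b \<in> K"
        then have "Yb b \<union> {i \<in> I. f (e b) i \<notin> underS r (g i)} \<in> K"
          using gK[OF that] by (rule sigma_ideal_Un[OF K])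
        moreover have "X \<subseteq> Yb b \<union> {i \<in> I. f (e b) i \<notin> underS r (g i)}"
          using XI unfolding Yb_def by auto
        ultimately have "X \<in> K" by (rule sigma_ideal_subset[OF K])
        then show False using XK by simp
      qed
      then show ?thesis unfolding good_def Yb_def by auto
    qed
    define q where "q b i = (SOME a. a \<in> Q i \<and> f (e b) i \<in> a)" for b i
    have q: "q b i \<in> Q i" "f (e b) i \<in> q b i" if "b \<in> x" "i \<in> Yb b" for b i
    proof -
      have "i \<in> X" "f (e b) i \<in> xi i" using that unfolding Yb_def xi_def by auto
      then have "\<exists>a. a \<in> Q i \<and> f (e b) i \<in> a" using Qx[of i] by auto
      then show "q b i \<in> Q i" "f (e b) i \<in> q b i"
        unfolding q_def using someI_ex[of "\<lambda>a. a \<in> Q i \<and> f (e b) i \<in> a"] by simp_all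
    qed
    \<comment> \<open>Elements with the same selection share a member of \<open>P\<close>.
      Selections are recorded as graphs of varying domain, all subsets of \<open>Sigma X Q\<close>,
      so their number is bounded by one further power set: hence the \<open>Suc\<close>.\<close>
    define gr where "gr b = (\<lambda>i. (i, q b i)) ` Yb b" for b
    have "\<forall>t\<in>gr ` x. \<exists>p. p \<in> P \<and> (\<forall>b\<in>D. (\<forall>(i, a)\<in>t. f (e b) i \<in> a) \<longrightarrow> b \<in> p)"
    proof
      fix t assume "t \<in> gr ` x"
      then obtain b where b: "b \<in> x" and t: "t = gr b" by auto
      have "q b i \<in> T i" if "i \<in> Yb b" for i
        using q(1)[OF b that] QT that unfolding Yb_def by auto
      with Yb[of b] b x(1) have "\<exists>p\<in>P. \<forall>b'\<in>D. (\<forall>i\<in>Yb b. f (e b') i \<in> q b i) \<longrightarrow> b' \<in> p"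
        by (intro block) auto
      then show "\<exists>p. p \<in> P \<and> (\<forall>b\<in>D. (\<forall>(i, a)\<in>t. f (e b) i \<in> a) \<longrightarrow> b \<in> p)"
        unfolding t gr_def by simp metis
    qed
    from bchoice[OF this] obtain p where
      "\<forall>t\<in>gr ` x. p t \<in> P \<and> (\<forall>b\<in>D. (\<forall>(i, a)\<in>t. f (e b) i \<in> a) \<longrightarrow> b \<in> p t)"
      by (rule exE)
    note p = bspec[OF this]
    have "x \<subseteq> \<Union>(p ` gr ` x)"
    proof
      fix b assume b: "b \<in> x"
      have "\<forall>(i, a)\<in>gr b. f (e b) i \<in> a" using q(2)[OF b] unfolding gr_def by auto
      then have "b \<in> p (gr b)" using p[of "gr b"] b x(1) by auto
      then show "b \<in> \<Union>(p ` gr ` x)" using b by auto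
    qed
    moreover have "p ` gr ` x \<subseteq> P" using p by auto
    moreover have "|p ` gr ` x| \<le>o |B (Suc (max nI n))|"
    proof -
      have "gr ` x \<subseteq> Pow (Sigma X Q)" using q(1) unfolding gr_def Yb_def by auto
      moreover have "|X| \<le>o |B nI|" using card_of_mono1[OF XI] I by (rule ordLeq_transitive)
      then have "|Pow (Sigma X Q)| \<le>o |B (Suc (max nI n))|"
        using Qc by (intro beth_seq_Pow[OF B] beth_seq_Sigma[OF B])
      ultimately have "|gr ` x| \<le>o |B (Suc (max nI n))|"
        using card_of_mono1 ordLeq_transitive by metis
      then show ?thesis by (rule card_of_image_ordLeq)
    qed
    ultimately show ?thesis by (intro exI[of _ "p ` gr ` x"] conjI)
  qed
  have "covered B (Suc (max nI n)) D"
    unfolding covered_def using P_card P_small cover by (intro exI[of _ P]) simp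
  then show ?thesis by (rule exI)
qed

end

subsection \<open>The covering theorem\<close>

text \<open>Induction on \<open>d\<close>. A small \<open>underS r d\<close> covers itself.
  Otherwise its size is at least every beth_n, and if countable unions do not suffice, a minimal
  bound \<open>h\<close> reduces the claim to ordinals below the values of \<open>h\<close>.\<close>

lemma exists_covered:
  fixes r :: "'a rel" and B :: "nat \<Rightarrow> 'c set"
  assumes r: "Well_order r" and B: "beth_seq B"
  shows "d \<in> Field r \<Longrightarrow> underS r d \<noteq> {} \<Longrightarrow> \<exists>n. covered B n (underS r d)"
proof (induction d rule: wf_induct_rule[OF conjunct2[OF r[unfolded well_order_on_def]]])
  case (1 d)
  let ?D = "underS r d"
  have B0: "|{a}| \<le>o |B 0|" for a :: "'a set"
    using beth_seq_infinite[OF B, of 0] by (intro card_of_singl_ordLeq) auto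
  show ?case
  proof (cases "small B ?D")
    case True
    have "covered B 0 ?D"
      unfolding covered_def
    proof (rule exI[of _ "{?D}"], intro conjI allI impI)
      show "\<forall>a\<in>{?D}. a \<subseteq> ?D \<and> small B a" using True by simp
      show "|{?D}| \<le>o |?D|" using 1(3) by (rule card_of_singl_ordLeq)
    next
      fix x assume "x \<subseteq> ?D"
      then show "\<exists>Q\<subseteq>{?D}. |Q| \<le>o |B 0| \<and> x \<subseteq> \<Union>Q"
        using B0 by (intro exI[of _ "{?D}"] conjI) simp_all
    qed
    then show ?thesis by (rule exI)
  next
    case False
    then have BD: "|B n| \<le>o |?D|" for n
      unfolding small_def using not_ordLeq_card ordLess_imp_ordLeq by metis
    have D: "infinite ?D"
      using card_of_ordLeq_infinite[OF BD beth_seq_infinite[OF B]] .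
    show ?thesis
    proof (cases "covered B 0 ?D")
      case nc: False
      let ?G = "Field (cardSuc |?D| )"
      from differing_family_if_not_covered[OF B BD nc] obtain n J f
        where J: "sigma_ideal (B n) J" and f: "\<forall>a\<in>?G. \<forall>i\<in>B n. f a i \<in> ?D"
          and diff: "differing J (B n) ?G f"
        by (elim exE conjE)
      \<comment> \<open>The constant bound \<open>d\<close> starts the minimization; the minimal
        bound is at most \<open>d\<close> everywhere, so points below its values fall under the
        induction hypothesis.\<close>
      have "large_below r J ?G (B n) (\<lambda>i. d)"
        using f diff unfolding large_below_def by (intro exI[of _ f] conjI)
      from exists_minimal_large_below[OF r J 1(2) this] obtain Y K h
        where Y: "Y \<subseteq> B n" and K: "sigma_ideal Y K" and h: "\<forall>i\<in>Y. (h i, d) \<in> r"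
          and large: "large_below r K ?G Y h"
          and min: "\<forall>N\<in>K. \<forall>h'. (\<forall>i\<in>Y - N. h' i \<in> underS r (h i)) \<longrightarrow> \<not> large_below r K ?G (Y - N) h'"
        by (elim exE conjE)
      obtain f' where f': "\<forall>a\<in>?G. \<forall>i\<in>Y. f' a i \<in> underS r (h i)" and diff': "differing K Y ?G f'"
        using large unfolding large_below_def by (elim exE conjE)
      have YB: "|Y| \<le>o |B n|" using Y by (rule card_of_mono1)
      interpret minimal_family r Y K ?D h f'
      proof
        show "|Pow Y| \<le>o |?D|" using beth_seq_Pow[OF B YB] BD by (rule ordLeq_transitive)
      qed (use r K D f' diff' min in auto)
      have "\<exists>n. covered B n (underS r g)"
        if "i \<in> Y" "g \<in> underS r (h i)" "underS r g \<noteq> {}" for i g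
      proof (rule 1(1))
        have "trans r" "antisym r" using r unfolding order_on_defs by simp_all
        moreover have "(h i, d) \<in> r" "(g, h i) \<in> r" "g \<noteq> h i"
          using h that(1,2) unfolding underS_def by auto
        ultimately show "(g, d) \<in> r - Id" unfolding trans_def antisym_def by auto
        then show "g \<in> Field r" unfolding Field_def by auto
      qed (rule that(3))
      then show ?thesis by (intro covered_step[OF B YB])
    qed (rule exI)
  qed
qed

subsection \<open>Points of prescribed cofinality and clubs\<close>

lemma regular_cardinal_bounded:
  assumes r: "regular_cardinal r" and X: "X \<subseteq> Field r" "|X| <o r"
  shows "\<exists>d\<in>Field r. X \<subseteq> underS r d"
proof -
  have card: "Card_order r" and inf: "infinite (Field r)" and reg: "regularCard r"
    using r unfolding regular_cardinal_def by simp_all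
  have wo: "trans r" "antisym r" "total_on (Field r) r" "Refl r"
    using card unfolding card_order_on_def order_on_defs by simp_all
  have "\<not> cofinal X r"
    using reg X not_ordLess_ordIso unfolding regularCard_def by metis
  then obtain a where a: "a \<in> Field r" and *: "\<forall>b\<in>X. \<not> (a \<noteq> b \<and> (a, b) \<in> r)"
    unfolding cofinal_def by auto
  obtain d where d: "d \<in> Field r" "a \<noteq> d" "(a, d) \<in> r"
    using infinite_Card_order_limit[OF card inf a] by auto
  have "x \<in> underS r d" if "x \<in> X" for x
  proof -
    have "x \<in> Field r" using that X by auto
    then have "(x, a) \<in> r"
      using wo(3,4) a that * unfolding total_on_def refl_on_def by metis
    then show ?thesis
      using d wo(1,2) unfolding trans_def antisym_def underS_def by auto
  qed
  then show ?thesis using d(1) by auto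
qed

text \<open>The point is the supremum of a strictly increasing sequence of length \<open>k\<close>
  in which every term exceeds the \<open>s\<close>-values of all earlier terms.\<close>

lemma closed_point_of_cofinality:
  assumes r: "regular_cardinal r" and k: "regular_cardinal k" "k <o r"
    and s: "\<forall>a\<in>Field r. a \<in> underS r (s a) \<and> s a \<in> Field r" and a0: "a0 \<in> Field r"
  shows "\<exists>d\<in>S_cof r k. a0 \<in> underS r d \<and>
    (\<forall>a\<in>underS r d. \<exists>b\<in>underS r d. (a, b) \<in> r \<and> s b \<in> underS r d)"
proof -
  have card: "Card_order r" and inf: "infinite (Field r)"
    using r unfolding regular_cardinal_def by simp_all
  have kcard: "Card_order k" and kinf: "infinite (Field k)" and kreg: "regularCard k"
    using k unfolding regular_cardinal_def by simp_all
  have wor: "Well_order r" and wok: "Well_order k"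
    using card kcard unfolding card_order_on_def by simp_all
  have wo: "trans r" "antisym r" "total_on (Field r) r" "Refl r"
    using wor unfolding order_on_defs by simp_all
  have ko: "trans k" "antisym k" "total_on (Field k) k" "Refl k"
    using wok unfolding order_on_defs by simp_all
  have less_trans: "a \<in> underS r c" if "a \<in> underS r b" "(b, c) \<in> r" for a b c
    using that wo(1,2) unfolding trans_def antisym_def underS_def by auto
  have Field: "a \<in> Field r" if "a \<in> underS r b" for a b
    using that unfolding underS_def Field_def by auto
  have fin: "|X| <o r" if "finite X" for X :: "'a set"
    using finite_ordLess_infinite[OF card_of_Well_order wor] that inf by (simp add: Field_card_of)
  \<comment> \<open>The condition on the term at \<open>i\<close> of the sequence. For
    \<open>i\<close> outside \<open>Field k\<close> there are no earlier terms, so the recursion can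
    run over the whole type.\<close>
  define Q where "Q f i v \<longleftrightarrow> v \<in> Field r \<and> a0 \<in> underS r v \<and>
    (\<forall>j\<in>underS k i. s (f j) \<in> underS r v)" for f i v
  have "\<exists>g. \<forall>i. Q g i (g i)"
  proof (rule dependent_wf_choice[of "k - Id"])
    show "wf (k - Id)" using wok unfolding well_order_on_def by simp
  next
    fix f g :: "'b \<Rightarrow> 'a" and i v
    assume "\<And>z. (z, i) \<in> k - Id \<Longrightarrow> f z = g z"
    then show "Q f i v = Q g i v" unfolding Q_def underS_def by auto
  next
    fix i and f :: "'b \<Rightarrow> 'a"
    assume f: "\<And>j. (j, i) \<in> k - Id \<Longrightarrow> Q f j (f j)"
    let ?X = "{a0} \<union> (\<lambda>j. s (f j)) ` underS k i"
    have "f j \<in> Field r" if "j \<in> underS k i" for j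
      using f[of j] that unfolding Q_def underS_def by auto
    then have "?X \<subseteq> Field r" using s a0 by auto
    moreover have "|?X| <o r"
    proof (rule card_of_Un_ordLess_infinite_Field[OF inf card])
      show "|{a0}| <o r" by (rule fin) simp
      have "|underS k i| <o r"
      proof (cases "i \<in> Field k")
        case True
        show ?thesis using ordLess_transitive[OF card_of_underS[OF kcard True] k(2)] .
      next
        case False
        then have "underS k i = {}" by (rule underS_empty)
        show ?thesis
          unfolding \<open>underS k i = {}\<close>
          using inf by (intro finite_ordLess_infinite[OF card_of_Well_order wor]) (simp_all add: Field_card_of)
      qed
      then show "|(\<lambda>j. s (f j)) ` underS k i| <o r"
        using card_of_image ordLeq_ordLess_trans by metis
    qed
    ultimately show "\<exists>v. Q f i v"
      using regular_cardinal_bounded[OF r, of ?X] unfolding Q_def by auto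
  qed
  then obtain g where "\<forall>i. Q g i (g i)" by (rule exE)
  note g = spec[OF this]
  have gF: "g i \<in> Field r" and ga0: "a0 \<in> underS r (g i)" for i
    using g[of i] unfolding Q_def by simp_all
  have sg: "s (g j) \<in> underS r (g i)" if "j \<in> underS k i" for i j
    using g[of i] that unfolding Q_def by simp
  have g_less: "g j \<in> underS r (g i)" if "j \<in> underS k i" for i j
    using less_trans[of "g j" "s (g j)" "g i"] bspec[OF s gF] sg[OF that] unfolding underS_def by auto
  have klimit: "\<exists>i'\<in>Field k. i \<in> underS k i'" if "i \<in> Field k" for i
    using infinite_Card_order_limit[OF kcard kinf that] unfolding underS_def by auto
  have fieldk: "|Field k| =o k" by (rule card_of_Field_ordIso[OF kcard])
  have "|g ` Field k| <o r"
    using card_of_image fieldk k(2) ordLeq_ordIso_trans ordLeq_ordLess_trans by metis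
  then obtain d0 where d0: "d0 \<in> Field r" "g ` Field k \<subseteq> underS r d0"
    using regular_cardinal_bounded[OF r, of "g ` Field k"] gF by auto
  \<comment> \<open>The least strict upper bound of the sequence; it is a supremum because
    \<open>k\<close> has no last element.\<close>
  define U where "U = {d \<in> Field r. g ` Field k \<subseteq> underS r d}"
  have U: "U \<subseteq> Field r" "U \<noteq> {}" using d0 unfolding U_def by auto
  define d where "d = wo_rel.minim r U"
  have dU: "d \<in> U" and d_min: "\<And>b. b \<in> U \<Longrightarrow> (d, b) \<in> r"
    unfolding d_def using wo_rel.minim_in[OF _ U] wo_rel.minim_least[OF _ U(1)] wor
    unfolding wo_rel_def by auto
  have gd: "g i \<in> underS r d" if "i \<in> Field k" for i using dU that unfolding U_def by auto
  have d_cof: "\<exists>i\<in>Field k. (a, g i) \<in> r" if a: "a \<in> underS r d" for a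
  proof (rule ccontr)
    assume "\<not> ?thesis"
    then have "\<forall>i\<in>Field k. g i \<in> underS r a"
      using Field[OF a] gF wo(3,4) unfolding total_on_def underS_def refl_on_def by (simp, metis)
    then have "a \<in> U" using Field[OF a] unfolding U_def by auto
    then show False using d_min a wo(2) unfolding underS_def antisym_def by auto
  qed
  have inj: "inj_on g (Field k)"
  proof (rule inj_onI, rule ccontr)
    fix i j assume ij: "i \<in> Field k" "j \<in> Field k" "g i = g j" "i \<noteq> j"
    then have "i \<in> underS k j \<or> j \<in> underS k i"
      using ko(3) unfolding total_on_def underS_def by auto
    then show False using g_less[of i j] g_less[of j i] ij(3) unfolding underS_def by auto
  qed
  have "|g ` Field k| =o |Field k|"
    using inj by (intro ordIso_symmetric[OF card_of_ordIsoI[of g]]) (simp add: bij_betw_def)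
  then have gk: "|g ` Field k| =o k" using fieldk by (rule ordIso_transitive)
  \<comment> \<open>Sending each point of \<open>L\<close> to an index whose term is above it maps
    \<open>L\<close> onto a cofinal subset of \<open>k\<close>, which has full size by
    regularity.\<close>
  have "k \<le>o |L|" if L: "L \<subseteq> underS r d" "\<forall>a\<in>underS r d. \<exists>b\<in>L. (a, b) \<in> r" for L
  proof -
    have "\<forall>b\<in>L. \<exists>i. i \<in> Field k \<and> (b, g i) \<in> r" using d_cof L(1) by auto
    from bchoice[OF this] obtain t where t: "\<forall>b\<in>L. t b \<in> Field k \<and> (b, g (t b)) \<in> r"
      by (rule exE)
    have "cofinal (t ` L) k"
      unfolding cofinal_def
    proof
      fix i assume "i \<in> Field k"
      then obtain i' where i': "i' \<in> Field k" "i \<in> underS k i'" using klimit by auto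
      obtain b where b: "b \<in> L" "(g i', b) \<in> r" using L(2) gd[OF i'(1)] by auto
      then have tb: "t b \<in> Field k" "(g i', g (t b)) \<in> r"
        using t wo(1) unfolding trans_def by auto
      have "(i', t b) \<in> k"
      proof (rule ccontr)
        assume "(i', t b) \<notin> k"
        then have "t b \<in> underS k i'"
          using ko(3,4) i'(1) tb(1) unfolding total_on_def refl_on_def underS_def by (simp, metis)
        then show False using g_less tb(2) wo(2) unfolding underS_def antisym_def by auto
      qed
      then have "i \<noteq> t b \<and> (i, t b) \<in> k"
        using i'(2) ko(1,2) unfolding underS_def trans_def antisym_def by auto
      then show "\<exists>b\<in>t ` L. i \<noteq> b \<and> (i, b) \<in> k" using b(1) by auto
    qed
    moreover have "t ` L \<subseteq> Field k" using t by auto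
    ultimately have "|t ` L| =o k" using kreg unfolding regularCard_def by simp
    then show ?thesis using card_of_image ordIso_symmetric ordIso_ordLeq_trans by metis
  qed
  then have "cof_is r d k"
    unfolding cof_is_def using gk gd d_cof by (intro conjI exI[of _ "g ` Field k"]) auto
  then have "d \<in> S_cof r k" using dU unfolding S_cof_def U_def by simp
  moreover obtain i0 where i0: "i0 \<in> Field k" using kinf by fastforce
  have "a0 \<in> underS r d"
    using less_trans[OF ga0[of i0]] gd[OF i0] unfolding underS_def by auto
  moreover have "\<exists>b\<in>underS r d. (a, b) \<in> r \<and> s b \<in> underS r d" if a: "a \<in> underS r d" for a
  proof -
    obtain i where i: "i \<in> Field k" "(a, g i) \<in> r" using d_cof[OF a] by auto
    obtain i' where i': "i' \<in> Field k" "i \<in> underS k i'" using klimit[OF i(1)] by auto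
    have "s (g i) \<in> underS r d"
      using less_trans[OF sg[OF i'(2)]] gd[OF i'(1)] unfolding underS_def by auto
    then show ?thesis using i gd by auto
  qed
  ultimately show ?thesis by auto
qed

text \<open>If each \<open>n\<close> failed at some \<open>d n\<close>, these countably many points
  would lie below one \<open>D\<close>. The \<open>n\<close> that works for \<open>D\<close> also
  works for \<open>d n\<close>, by intersecting the members with
  \<open>underS r (d n)\<close>.\<close>

lemma uniformly_covered:
  fixes r :: "'a rel" and B :: "nat \<Rightarrow> 'c set"
  assumes r: "regular_cardinal r" and B: "beth_seq B" and Br: "\<And>n. |B n| <o r"
  shows "\<exists>n. \<forall>d\<in>Field r. \<exists>P. (\<forall>a\<in>P. a \<subseteq> underS r d \<and> small B a) \<and> |P| <o r \<and>
    (\<forall>x\<subseteq>underS r d. small B x \<longrightarrow> (\<exists>Q\<subseteq>P. |Q| \<le>o |B n| \<and> x \<subseteq> \<Union>Q))"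
    (is "\<exists>n. \<forall>d\<in>Field r. ?cov n d")
proof (rule ccontr)
  have card: "Card_order r" and wor: "Well_order r"
    using r unfolding regular_cardinal_def card_order_on_def by simp_all
  have trans: "trans r" "antisym r" using wor unfolding order_on_defs by simp_all
  assume "\<not> ?thesis"
  then have "\<forall>n. \<exists>d. d \<in> Field r \<and> \<not> ?cov n d"
    by (simp only: not_ex Ball_def not_all not_imp simp_thms)
  from choice[OF this] obtain d where d: "\<forall>n. d n \<in> Field r \<and> \<not> ?cov n (d n)"
    by (rule exE)
  have "|range d| <o r"
    using card_of_image beth_seq_nat[OF B, of 0] Br[of 0] ordLeq_ordLess_trans by metis
  then obtain D where D: "D \<in> Field r" "range d \<subseteq> underS r D"
    using regular_cardinal_bounded[OF r, of "range d"] d by auto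
  have "underS r D \<noteq> {}" using D(2) by auto
  from exists_covered[OF wor B D(1) this] obtain n where n: "covered B n (underS r D)"
    by (rule exE)
  from n obtain P where P: "\<forall>a\<in>P. a \<subseteq> underS r D \<and> small B a" "|P| \<le>o |underS r D|"
    and cov: "\<forall>x\<subseteq>underS r D. small B x \<longrightarrow> (\<exists>Q\<subseteq>P. |Q| \<le>o |B n| \<and> x \<subseteq> \<Union>Q)"
    unfolding covered_def by (elim exE conjE)
  have "d n \<in> underS r D" using D(2) by auto
  then have sub: "underS r (d n) \<subseteq> underS r D"
    using trans unfolding underS_def trans_def antisym_def by auto
  let ?P = "(\<inter>) (underS r (d n)) ` P"
  have "?cov n (d n)"
  proof (rule exI[of _ ?P], intro conjI allI impI ballI)
    fix a assume "a \<in> ?P"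
    then obtain p where p: "p \<in> P" "a = underS r (d n) \<inter> p" by auto
    then show "a \<subseteq> underS r (d n)" by simp
    have "|a| \<le>o |p|" unfolding p(2) by (rule card_of_mono1) simp
    then show "small B a" using P(1) p(1) ordLeq_transitive unfolding small_def by metis
  next
    have "|underS r D| <o r" using card D(1) by (rule card_of_underS)
    then show "|?P| <o r"
      using P(2) card_of_image ordLeq_ordLess_trans by metis
  next
    fix x assume x: "x \<subseteq> underS r (d n)" "small B x"
    then obtain Q where Q: "Q \<subseteq> P" "|Q| \<le>o |B n|" "x \<subseteq> \<Union>Q"
      using cov sub by (metis subset_trans)
    have "x \<subseteq> \<Union>((\<inter>) (underS r (d n)) ` Q)" using x(1) Q(3) by auto
    moreover have "(\<inter>) (underS r (d n)) ` Q \<subseteq> ?P" using Q(1) by (rule image_mono)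
    moreover have "|(\<inter>) (underS r (d n)) ` Q| \<le>o |B n|"
      using Q(2) by (rule card_of_image_ordLeq)
    ultimately show "\<exists>Q'\<subseteq>?P. |Q'| \<le>o |B n| \<and> x \<subseteq> \<Union>Q'"
      by (intro exI[of _ "(\<inter>) (underS r (d n)) ` Q"] conjI)
  qed
  then show False using d by simp
qed

text \<open>Two quantities below beth_omega may come with different beth sequences; this makes them
  comparable.\<close>

lemma beth_seq_unique:
  assumes "beth_seq B" "beth_seq C"
  shows "|B n| =o |C n|"
proof (induction n)
  case 0
  then show ?case
    using assms ordIso_symmetric ordIso_transitive unfolding beth_seq_def by metis
next
  case (Suc n)
  have "|Pow (B n)| =o |Pow (C n)|"
    using Suc card_of_Pow_mono unfolding ordIso_iff_ordLeq by metis
  then show ?case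
    using assms ordIso_symmetric ordIso_transitive unfolding beth_seq_def by metis
qed

lemma unbounded_if_full_card:
  assumes r: "regular_cardinal r" and A: "A \<subseteq> Field r" "|A| =o r" and a: "a \<in> Field r"
  shows "\<exists>b\<in>A. a \<in> underS r b"
proof (rule ccontr)
  assume n: "\<not> ?thesis"
  have card: "Card_order r" and inf: "infinite (Field r)"
    using r unfolding regular_cardinal_def by simp_all
  have wo: "trans r" "antisym r" "total_on (Field r) r" "Refl r"
    using card unfolding card_order_on_def order_on_defs by simp_all
  obtain d where d: "d \<in> Field r" "a \<noteq> d" "(a, d) \<in> r"
    using infinite_Card_order_limit[OF card inf a] by auto
  have "b \<in> underS r d" if "b \<in> A" for b
  proof -
    have "b \<in> Field r" using that A(1) by auto
    then have "(b, a) \<in> r"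
      using wo(3,4) a that n unfolding total_on_def refl_on_def underS_def by (simp, metis)
    then show ?thesis
      using d wo(1,2) unfolding trans_def antisym_def underS_def by auto
  qed
  then have "|A| \<le>o |underS r d|" by (intro card_of_mono1) auto
  then have "|A| <o r" using card_of_underS[OF card d(1)] by (rule ordLeq_ordLess_trans)
  then show False using A(2) not_ordLess_ordIso by metis
qed

text \<open>Unboundedness comes from points of cofinality omega closed under a map \<open>s\<close>
  to later elements of \<open>A\<close>; closure holds since limits of limit points of
  \<open>A\<close> are limit points of \<open>A\<close>.\<close>

lemma club_limit_points:
  assumes r: "regular_cardinal r" and nat: "|UNIV :: nat set| <o r"
    and A: "A \<subseteq> Field r" "|A| =o r"
  shows "club r {d \<in> Field r. is_sup r (A \<inter> underS r d) d}"
  unfolding club_def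
proof (intro conjI ballI impI)
  have wor: "Well_order r" using r unfolding regular_cardinal_def card_order_on_def by simp
  then have wo: "trans r" "antisym r" unfolding order_on_defs by simp_all
  have less_trans: "a \<in> underS r c" if "(a, b) \<in> r" "b \<in> underS r c" for a b c
    using that wo unfolding trans_def antisym_def underS_def by auto
  {
    fix a assume a: "a \<in> Field r"
    define s where "s a = (SOME b. b \<in> A \<and> a \<in> underS r b)" for a
    have s: "s b \<in> A" "b \<in> underS r (s b)" if "b \<in> Field r" for b
      using someI_ex[of "\<lambda>c. c \<in> A \<and> b \<in> underS r c"] unbounded_if_full_card[OF r A that]
      unfolding s_def by auto
    have reg_nat: "regular_cardinal natLeq"
      using natLeq_Card_order regularCard_natLeq unfolding regular_cardinal_def
      by (simp add: Field_natLeq)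
    have s_less: "\<forall>b\<in>Field r. b \<in> underS r (s b) \<and> s b \<in> Field r"
      using s A(1) by auto
    have "natLeq <o r" by (rule ordIso_ordLess_trans[OF ordIso_symmetric[OF card_of_nat] nat])
    from closed_point_of_cofinality[OF r reg_nat this s_less a] obtain d
      where d: "d \<in> S_cof r natLeq" "a \<in> underS r d"
        and ds: "\<forall>b\<in>underS r d. \<exists>c\<in>underS r d. (b, c) \<in> r \<and> s c \<in> underS r d"
      by (elim bexE conjE)
    have "\<exists>x\<in>A \<inter> underS r d. b \<noteq> x \<and> (b, x) \<in> r" if b: "b \<in> underS r d" for b
    proof -
      obtain c where c: "c \<in> underS r d" "(b, c) \<in> r" "s c \<in> underS r d" using ds b by auto
      have cF: "c \<in> Field r" using c(2) unfolding Field_def by auto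
      have "b \<in> underS r (s c)" using c(2) s(2)[OF cF] by (rule less_trans)
      then show ?thesis using c(3) s(1)[OF cF] unfolding underS_def by auto
    qed
    then have "is_sup r (A \<inter> underS r d) d" unfolding is_sup_def underS_def by auto
    then show "\<exists>b\<in>{d \<in> Field r. is_sup r (A \<inter> underS r d) d}. a \<noteq> b \<and> (a, b) \<in> r"
      using d unfolding S_cof_def underS_def by auto
  next
    fix d assume d: "d \<in> Field r" and "underS r d \<noteq> {} \<and>
      is_sup r ({d \<in> Field r. is_sup r (A \<inter> underS r d) d} \<inter> underS r d) d"
    then have sup: "\<forall>a\<in>underS r d.
        \<exists>x\<in>{d \<in> Field r. is_sup r (A \<inter> underS r d) d} \<inter> underS r d. a \<noteq> x \<and> (a, x) \<in> r"
      unfolding is_sup_def by simp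
    have "\<exists>x\<in>A \<inter> underS r d. b \<noteq> x \<and> (b, x) \<in> r" if b: "b \<in> underS r d" for b
    proof -
      obtain e where e: "e \<in> underS r d" "is_sup r (A \<inter> underS r e) e" "b \<in> underS r e"
        using bspec[OF sup b] unfolding underS_def by auto
      then obtain x where x: "x \<in> A" "x \<in> underS r e" "b \<noteq> x" "(b, x) \<in> r"
        unfolding is_sup_def by auto
      moreover have "x \<in> underS r d"
        using less_trans[OF _ e(1)] x(2) unfolding underS_def by auto
      ultimately show ?thesis by auto
    qed
    then have "is_sup r (A \<inter> underS r d) d" unfolding is_sup_def underS_def by auto
    then show "d \<in> {d \<in> Field r. is_sup r (A \<inter> underS r d) d}" using d by simp
  }
qed auto

subsection \<open>Guessing and counting\<close>

text \<open>A cofinal part of \<open>A\<close> of size at most \<open>k\<close> is split into at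
  most beth_n pieces. Since beth_n is below the cofinality \<open>k\<close>, some piece is
  cofinal.\<close>

lemma cofinal_part_in_covering_member:
  assumes wor: "Well_order r" and B: "beth_seq B" and d: "d \<in> S_cof r k"
    and k: "|B n| <o k" "k \<le>o |B m|"
    and P: "\<forall>x\<subseteq>underS r d. small B x \<longrightarrow> (\<exists>Q\<subseteq>P. |Q| \<le>o |B n| \<and> x \<subseteq> \<Union>Q)"
    and A: "is_sup r (A \<inter> underS r d) d"
  shows "\<exists>a\<in>P. \<exists>X\<subseteq>a. X \<subseteq> underS r d \<and> |X| \<le>o k \<and> X \<subseteq> A \<and> is_sup r X d"
proof -
  have wo: "trans r" "antisym r" "total_on (Field r) r" "Refl r"
    using wor unfolding order_on_defs by simp_all
  from d obtain L where L: "L \<subseteq> underS r d" "\<forall>a\<in>underS r d. \<exists>b\<in>L. (a, b) \<in> r" "|L| =o k"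
    and min: "\<And>L. L \<subseteq> underS r d \<and> (\<forall>a\<in>underS r d. \<exists>b\<in>L. (a, b) \<in> r) \<Longrightarrow> k \<le>o |L|"
    unfolding S_cof_def cof_is_def by auto
  have "\<forall>a\<in>L. \<exists>x. x \<in> A \<inter> underS r d \<and> a \<noteq> x \<and> (a, x) \<in> r"
    using A L(1) unfolding is_sup_def by auto
  from bchoice[OF this] obtain s where
    s: "\<forall>a\<in>L. s a \<in> A \<inter> underS r d \<and> a \<noteq> s a \<and> (a, s a) \<in> r"
    by (rule exE)
  have xk: "|s ` L| \<le>o k" using card_of_image L(3) by (rule ordLeq_ordIso_trans)
  then have "small B (s ` L)" using k(2) ordLeq_transitive unfolding small_def by metis
  moreover have sub: "s ` L \<subseteq> underS r d" using s by auto
  ultimately obtain Q where Q: "Q \<subseteq> P" "|Q| \<le>o |B n|" "s ` L \<subseteq> \<Union>Q"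
    using P by metis
  have "\<exists>a\<in>Q. \<forall>b\<in>underS r d. \<exists>x\<in>s ` L \<inter> a. b \<noteq> x \<and> (b, x) \<in> r"
  proof (rule ccontr)
    assume "\<not> ?thesis"
    \<comment> \<open>Bounds of the pieces, if all were bounded, would be cofinal in
      \<open>d\<close> and number at most beth_n.\<close>
    then have "\<forall>a\<in>Q. \<exists>b. b \<in> underS r d \<and> (\<forall>x\<in>s ` L \<inter> a. \<not> (b \<noteq> x \<and> (b, x) \<in> r))" by auto
    from bchoice[OF this] obtain t where
      t: "\<forall>a\<in>Q. t a \<in> underS r d \<and> (\<forall>x\<in>s ` L \<inter> a. \<not> (t a \<noteq> x \<and> (t a, x) \<in> r))"
      by (rule exE)
    have "\<exists>b\<in>t ` Q. (a, b) \<in> r" if a: "a \<in> underS r d" for a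
    proof -
      obtain l where l: "l \<in> L" "(a, l) \<in> r" using L(2) a by auto
      then obtain q where q: "q \<in> Q" "s l \<in> q" using Q(3) by auto
      then have "\<not> (t q \<noteq> s l \<and> (t q, s l) \<in> r)" using t l(1) by auto
      moreover have "t q \<in> Field r" "s l \<in> Field r"
        using t q(1) s l(1) unfolding underS_def Field_def by auto
      ultimately have "(s l, t q) \<in> r" using wo(3,4) unfolding total_on_def refl_on_def by metis
      moreover have "(l, s l) \<in> r" using s l(1) by simp
      ultimately have "(a, t q) \<in> r" using l(2) wo(1) unfolding trans_def by metis
      then show ?thesis using q(1) by auto
    qed
    then have "k \<le>o |t ` Q|" using t by (intro min) auto
    moreover have "|t ` Q| \<le>o |B n|" using Q(2) by (rule card_of_image_ordLeq)
    ultimately have "k \<le>o |B n|" by (rule ordLeq_transitive)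
    then show False using k(1) not_ordLess_ordLeq by metis
  qed
  then obtain a where a: "a \<in> Q" "\<forall>b\<in>underS r d. \<exists>x\<in>s ` L \<inter> a. b \<noteq> x \<and> (b, x) \<in> r"
    by (rule bexE)
  have "is_sup r (s ` L \<inter> a) d"
    using a(2) sub unfolding is_sup_def underS_def by auto
  moreover have "s ` L \<inter> a \<subseteq> A" "s ` L \<inter> a \<subseteq> underS r d" using s by auto
  moreover have "|s ` L \<inter> a| \<le>o k" using card_of_mono1[OF Int_lower1] xk by (rule ordLeq_transitive)
  ultimately show ?thesis
    using a(1) Q(1) by (intro bexI[of _ a] exI[of _ "s ` L \<inter> a"] conjI) auto
qed

text \<open>A subset of size at most \<open>k\<close> is the union of its intersections with at most
  beth_n members of \<open>P\<close>. These lie in \<open>R\<close>, so functions from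
  \<open>B n\<close> to \<open>R\<close> encode all such subsets.\<close>

lemma small_subsets_ordLess:
  fixes r :: "'a rel" and B :: "nat \<Rightarrow> 'a set"
  assumes r: "regular_cardinal r" and B: "beth_seq B" and k: "k \<le>o |B m|"
    and P: "\<forall>x\<subseteq>underS r d. small B x \<longrightarrow> (\<exists>Q\<subseteq>P. |Q| \<le>o |B n| \<and> x \<subseteq> \<Union>Q)"
    and R: "\<And>a y. a \<in> P \<Longrightarrow> y \<subseteq> a \<Longrightarrow> |y| \<le>o k \<Longrightarrow> y \<in> R" and Rr: "|R| <o r"
    and exp: "\<And>t :: 'a rel. Card_order t \<Longrightarrow> t <o r \<Longrightarrow> t ^c |B n| <o r"
  shows "|small_subsets r k d| <o r"
proof -
  have card: "Card_order r" and inf: "infinite (Field r)"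
    using r unfolding regular_cardinal_def by simp_all
  have wor: "Well_order r" using card unfolding card_order_on_def by simp
  let ?F = "Func (B n) R"
  \<comment> \<open>The hypothesis on powers concerns cardinals on \<open>'a\<close>, while
    \<open>R\<close> consists of sets; hence the equipotent copy.\<close>
  obtain t :: "'a set" where t: "|R| =o |t|" "|t| <o r"
    using Rr internalize_card_of_ordLess[of R r] by auto
  have "|?F| =o |t| ^c |B n|"
    using cexp_cong1[OF t(1) card_of_Card_order, of "B n"] unfolding cexp_def Field_card_of .
  then have F: "|?F| <o r"
    using exp[OF card_of_Card_order t(2)] by (rule ordIso_ordLess_trans)
  have "small_subsets r k d \<subseteq> {{}} \<union> (\<lambda>f. \<Union>(f ` B n)) ` ?F"
  proof
    fix x assume "x \<in> small_subsets r k d"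
    then have x: "x \<subseteq> underS r d" "|x| \<le>o k" unfolding small_subsets_def by simp_all
    then have "small B x" using k ordLeq_transitive unfolding small_def by metis
    then obtain Q where Q: "Q \<subseteq> P" "|Q| \<le>o |B n|" "x \<subseteq> \<Union>Q" using P x(1) by metis
    show "x \<in> {{}} \<union> (\<lambda>f. \<Union>(f ` B n)) ` ?F"
    proof (cases "Q = {}")
      case True
      then show ?thesis using Q(3) by simp
    next
      case False
      then obtain g where g: "g ` B n = Q" using card_of_ordLeq2[OF False] Q(2) by metis
      \<comment> \<open>\<open>undefined\<close> off \<open>B n\<close> is the normalization in
        \<open>Func\<close>. An empty \<open>Q\<close> has no enumeration by \<open>B n\<close>, so
        the empty set was split off.\<close>
      define f where "f i = (if i \<in> B n then x \<inter> g i else undefined)" for i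
      have "f i \<in> R" if "i \<in> B n" for i
      proof -
        have "g i \<in> P" using that g Q(1) by auto
        moreover have "|x \<inter> g i| \<le>o k"
          using card_of_mono1[OF Int_lower1] x(2) by (rule ordLeq_transitive)
        ultimately show ?thesis using R[of "g i" "x \<inter> g i"] that unfolding f_def by simp
      qed
      then have "f \<in> ?F" unfolding Func_def f_def by simp
      moreover have "\<Union>(f ` B n) = x" using g Q(3) unfolding f_def by auto
      ultimately show ?thesis by auto
    qed
  qed
  then have "|small_subsets r k d| \<le>o |{{}} \<union> (\<lambda>f. \<Union>(f ` B n)) ` ?F|"
    by (rule card_of_mono1)
  moreover have "|{{}} \<union> (\<lambda>f. \<Union>(f ` B n)) ` ?F| <o r"
  proof (rule card_of_Un_ordLess_infinite_Field[OF inf card])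
    show "|{{}}| <o r"
      by (rule finite_ordLess_infinite[OF card_of_Well_order wor]) (simp_all add: Field_card_of inf)
    show "|(\<lambda>f. \<Union>(f ` B n)) ` ?F| <o r" using card_of_image F by (rule ordLeq_ordLess_trans)
  qed
  ultimately show ?thesis by (rule ordLeq_ordLess_trans)
qed

section \<open>The three statements on guessing and counting at cofinality kappa\<close>

theorem theorem2p1:
  fixes r :: "'a rel"
  assumes "regular_cardinal r"
    and "beth_omega_less r"
  shows "\<exists>k0 :: 'a rel. Card_order k0 \<and> less_beth_omega k0 \<and>
    (\<forall>k :: 'a rel. regular_cardinal k \<and> k0 <=o k \<and> less_beth_omega k \<longrightarrow>
      ((\<forall>m :: 'a rel. Card_order m \<and> m <o k \<longrightarrow> BNF_Cardinal_Arithmetic.cexp r m <=o r) \<longrightarrow>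
         (\<exists>P :: 'a \<Rightarrow> 'a set set.
            (\<forall>\<delta>\<in>S_cof r k. P \<delta> \<subseteq> small_subsets r k \<delta> \<and> card_of (P \<delta>) <o r) \<and>
            (\<forall>A. A \<subseteq> Field r \<and> card_of (A) =o r \<longrightarrow>
               stationary r {\<delta> \<in> S_cof r k. \<exists>X\<in>P \<delta>. X \<subseteq> A \<and> is_sup r X \<delta>})))
      \<and>
      (\<exists>P0 :: 'a \<Rightarrow> 'a set set.
         (\<forall>\<delta>\<in>S_cof r k. P0 \<delta> \<subseteq> small_subsets r k \<delta> \<and> card_of (P0 \<delta>) <o r) \<and>
         (\<forall>A. A \<subseteq> Field r \<and> card_of (A) =o r \<longrightarrow>
            (\<exists>E. club r E \<and> (\<forall>\<delta>\<in>E \<inter> S_cof r k. \<exists>a\<in>P0 \<delta>. is_sup r (A \<inter> a) \<delta>))))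
      \<and>
      ((\<forall>(t :: 'a rel) (m :: 'a rel). Card_order t \<and> t <o r \<and> Card_order m \<and> m <o k \<longrightarrow>
           BNF_Cardinal_Arithmetic.cexp t m <o r) \<longrightarrow>
         (\<exists>R :: 'a \<Rightarrow> 'a set set.
            (\<forall>\<delta>\<in>S_cof r k. R \<delta> \<subseteq> small_subsets r k \<delta> \<and> card_of (R \<delta>) <o r) \<and>
            (\<forall>a :: 'a \<Rightarrow> 'a set.
               (\<forall>\<delta>\<in>S_cof r k. a \<delta> \<subseteq> underS r \<delta> \<and> Restr r (a \<delta>) <=o k) \<longrightarrow>
               (\<exists>C. club r C \<and> (\<forall>\<delta>\<in>C \<inter> S_cof r k. a \<delta> \<in> R \<delta>))))))"
proof -
  have card: "Card_order r" and inf: "infinite (Field r)" and reg: "regularCard r"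
    using assms(1) unfolding regular_cardinal_def by simp_all
  have wor: "Well_order r" using card unfolding card_order_on_def by simp
  have stable: "stable r" by (rule regularCard_stable[OF card inf reg])
  obtain B :: "nat \<Rightarrow> 'a set" where B: "beth_seq B" and UB: "card_of (\<Union>(range B)) <o r"
    using assms(2) unfolding beth_omega_less_def by (elim exE conjE)
  have Br: "card_of (B n) <o r" for n
    by (rule ordLeq_ordLess_trans[OF card_of_mono1 UB]) auto
  have nat: "card_of (UNIV :: nat set) <o r"
    using beth_seq_nat[OF B] Br by (rule ordLeq_ordLess_trans)
  from uniformly_covered[OF assms(1) B Br] obtain n where
    "\<forall>d\<in>Field r. \<exists>P. (\<forall>a\<in>P. a \<subseteq> underS r d \<and> small B a) \<and> card_of P <o r \<and>
      (\<forall>x\<subseteq>underS r d. small B x \<longrightarrow> (\<exists>Q\<subseteq>P. card_of Q <=o card_of (B n) \<and> x \<subseteq> \<Union>Q))"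
    by (rule exE)
  from bchoice[OF this] obtain P where
    "\<forall>d\<in>Field r. (\<forall>a\<in>P d. a \<subseteq> underS r d \<and> small B a) \<and> card_of (P d) <o r \<and>
      (\<forall>x\<subseteq>underS r d. small B x \<longrightarrow> (\<exists>Q\<subseteq>P d. card_of Q <=o card_of (B n) \<and> x \<subseteq> \<Union>Q))"
    by (rule exE)
  note P = bspec[OF this]
  \<comment> \<open>Taking beth_(n+1) makes every \<open>k\<close> from \<open>k0\<close> on
    strictly larger than beth_n, as needed both for splitting a cofinal set and for using beth_n as
    an exponent below \<open>k\<close>.\<close>
  define k0 where "k0 = card_of (B (Suc n))"
  have k0: "Card_order k0" "less_beth_omega k0"
    unfolding k0_def less_beth_omega_def using card_of_Card_order B beth_seq_less[OF B] by auto
  show ?thesis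
  proof (intro exI[of _ k0] conjI k0 allI impI)
    fix k :: "'a rel"
    assume "regular_cardinal k \<and> k0 <=o k \<and> less_beth_omega k"
    then have k: "regular_cardinal k" "k0 <=o k" "less_beth_omega k" by simp_all
    from k(3) obtain C :: "nat \<Rightarrow> 'a set" and m where C: "beth_seq C" and km: "k <o card_of (C m)"
      unfolding less_beth_omega_def by (elim exE conjE)
    have kB: "k <o card_of (B m)"
      using km beth_seq_unique[OF C B] by (rule ordLess_ordIso_trans)
    have kr: "k <o r" using kB Br by (rule ordLess_transitive)
    have kleB: "k <=o card_of (B m)" using kB by (rule ordLess_imp_ordLeq)
    have Bk: "card_of (B n) <o k"
      using beth_seq_less[OF B] k(2) unfolding k0_def by (rule ordLess_ordLeq_trans)
    \<comment> \<open>Members of \<open>P d\<close> can be larger than \<open>k\<close>, so their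
      subsets of size at most \<open>k\<close> are taken. This family gives the first two statements
      and the coding for the third.\<close>
    define R where "R d = {y. \<exists>a\<in>P d. y \<subseteq> a \<and> card_of y <=o k}" for d
    have R_sub: "R d \<subseteq> small_subsets r k d" if "d \<in> Field r" for d
      using P[OF that] unfolding R_def small_subsets_def by auto
    have R_card: "card_of (R d) <o r" if d: "d \<in> Field r" for d
    proof -
      \<comment> \<open>Every beth number of finite index is below \<open>r\<close>, so a small set
        has fewer than \<open>r\<close> subsets; regularity then bounds the union over
        \<open>P d\<close>.\<close>
      have "card_of (Pow a) <o r" if "a \<in> P d" for a
      proof -
        have "small B a" using P[OF d] that by simp
        then obtain l where "card_of a <=o card_of (B l)" unfolding small_def by (rule exE)
        then show ?thesis by (rule ordLeq_ordLess_trans[OF beth_seq_Pow[OF B] Br])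
      qed
      moreover have "card_of (P d) <o r" using P[OF d] by simp
      ultimately have "card_of (\<Union>a\<in>P d. Pow a) <o r" by (intro stable_UNION[OF stable])
      moreover have "R d \<subseteq> (\<Union>a\<in>P d. Pow a)" unfolding R_def by auto
      ultimately show ?thesis using card_of_mono1 ordLeq_ordLess_trans by metis
    qed
    have S_Field: "d \<in> Field r" if "d \<in> S_cof r k" for d
      using that unfolding S_cof_def by simp
    have guess: "\<exists>X\<in>R d. X \<subseteq> A \<and> is_sup r X d"
      if d: "d \<in> S_cof r k" and A: "is_sup r (A \<inter> underS r d) d" for d A
    proof -
      have "\<exists>a\<in>P d. \<exists>X\<subseteq>a. X \<subseteq> underS r d \<and> card_of X <=o k \<and> X \<subseteq> A \<and> is_sup r X d"
        using P[OF S_Field[OF d]] by (intro cofinal_part_in_covering_member[OF wor B d Bk kleB _ A]) simp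
      then show ?thesis unfolding R_def by auto
    qed
    have R: "\<forall>d\<in>S_cof r k. R d \<subseteq> small_subsets r k d \<and> card_of (R d) <o r"
      using R_sub R_card S_Field by simp
    show "\<exists>Q. (\<forall>d\<in>S_cof r k. Q d \<subseteq> small_subsets r k d \<and> card_of (Q d) <o r) \<and>
      (\<forall>A. A \<subseteq> Field r \<and> card_of A =o r \<longrightarrow>
        stationary r {d \<in> S_cof r k. \<exists>X\<in>Q d. X \<subseteq> A \<and> is_sup r X d})"
    proof (intro exI[of _ R] conjI R allI impI)
      fix A assume A: "A \<subseteq> Field r \<and> card_of A =o r"
      have "{d \<in> S_cof r k. \<exists>X\<in>R d. X \<subseteq> A \<and> is_sup r X d} \<inter> E \<noteq> {}" if E: "club r E" for E
      proof -
        have trans: "trans r" "antisym r" using wor unfolding order_on_defs by simp_all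
        have unb: "\<exists>e\<in>E. b \<in> underS r e" if "b \<in> Field r" for b
          using E that unfolding club_def underS_def by auto
        \<comment> \<open>From \<open>b\<close> pass to an element of \<open>A\<close> and then to
          one of \<open>E\<close> above it. A point of cofinality \<open>k\<close> closed under
          \<open>s\<close> is a limit of both, so it lies in \<open>E\<close> and guessing applies
          there.\<close>
        define s where "s b = (SOME e. e \<in> E \<and> (\<exists>x\<in>A. b \<in> underS r x \<and> x \<in> underS r e))" for b
        have s: "s b \<in> E \<and> (\<exists>x\<in>A. b \<in> underS r x \<and> x \<in> underS r (s b))" if b: "b \<in> Field r" for b
          unfolding s_def
        proof (rule someI_ex)
          obtain x where x: "x \<in> A" "b \<in> underS r x"
            using unbounded_if_full_card[OF assms(1) conjunct1[OF A] conjunct2[OF A] b] by auto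
          then have "x \<in> Field r" using A by auto
          from unb[OF this] obtain e where "e \<in> E" "x \<in> underS r e" by (rule bexE)
          with x show "\<exists>e. e \<in> E \<and> (\<exists>x\<in>A. b \<in> underS r x \<and> x \<in> underS r e)"
            by (intro exI[of _ e] conjI bexI[of _ x])
        qed
        have underS_trans: "a \<in> underS r c" if "(a, b) \<in> r" "b \<in> underS r c" for a b c
          using that trans unfolding trans_def antisym_def underS_def by auto
        have s_less: "\<forall>b\<in>Field r. b \<in> underS r (s b) \<and> s b \<in> Field r"
        proof (intro ballI conjI)
          fix b assume b: "b \<in> Field r"
          show "s b \<in> Field r" using s[OF b] E unfolding club_def by auto
          obtain x where "b \<in> underS r x" "x \<in> underS r (s b)" using s[OF b] by auto
          then show "b \<in> underS r (s b)" using underS_trans unfolding underS_def by auto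
        qed
        obtain a0 where "a0 \<in> Field r" using inf by fastforce
        from closed_point_of_cofinality[OF assms(1) k(1) kr s_less this] obtain d
          where d: "d \<in> S_cof r k" "a0 \<in> underS r d"
            and ds: "\<forall>b\<in>underS r d. \<exists>c\<in>underS r d. (b, c) \<in> r \<and> s c \<in> underS r d"
          by (elim bexE conjE)
        have *: "\<exists>e\<in>E. \<exists>x\<in>A. b \<in> underS r x \<and> x \<in> underS r e \<and> e \<in> underS r d"
          if b: "b \<in> underS r d" for b
        proof -
          obtain c where c: "c \<in> underS r d" "(b, c) \<in> r" "s c \<in> underS r d" using ds b by auto
          have "c \<in> Field r" using c(2) unfolding Field_def by auto
          from s[OF this] obtain x where "s c \<in> E" "x \<in> A" "c \<in> underS r x" "x \<in> underS r (s c)"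
            by auto
          then show ?thesis using underS_trans[OF c(2)] c(3) by auto
        qed
        have "\<exists>x\<in>A \<inter> underS r d. b \<noteq> x \<and> (b, x) \<in> r" if b: "b \<in> underS r d" for b
        proof -
          obtain e x where "x \<in> A" "b \<in> underS r x" "x \<in> underS r e" "e \<in> underS r d"
            using *[OF b] by auto
          then show ?thesis using underS_trans[of x e d] unfolding underS_def by auto
        qed
        then have "is_sup r (A \<inter> underS r d) d" unfolding is_sup_def underS_def by auto
        moreover have "\<exists>x\<in>E \<inter> underS r d. b \<noteq> x \<and> (b, x) \<in> r" if b: "b \<in> underS r d" for b
        proof -
          obtain e x where e: "e \<in> E" "b \<in> underS r x" "x \<in> underS r e" "e \<in> underS r d"
            using *[OF b] by auto
          then have "b \<in> underS r e" using underS_trans[of b x e] unfolding underS_def by auto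
          then show ?thesis using e(1,4) unfolding underS_def by auto
        qed
        then have "is_sup r (E \<inter> underS r d) d" unfolding is_sup_def underS_def by auto
        then have "d \<in> E" using E d(2) S_Field[OF d(1)] unfolding club_def by auto
        ultimately show ?thesis using guess[OF d(1)] d(1) by auto
      qed
      then show "stationary r {d \<in> S_cof r k. \<exists>X\<in>R d. X \<subseteq> A \<and> is_sup r X d}"
        unfolding stationary_def using S_Field by auto
    qed
    show "\<exists>Q. (\<forall>d\<in>S_cof r k. Q d \<subseteq> small_subsets r k d \<and> card_of (Q d) <o r) \<and>
      (\<forall>A. A \<subseteq> Field r \<and> card_of A =o r \<longrightarrow>
        (\<exists>E. club r E \<and> (\<forall>d\<in>E \<inter> S_cof r k. \<exists>a\<in>Q d. is_sup r (A \<inter> a) d)))"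
    proof (intro exI[of _ R] conjI R allI impI)
      fix A assume A: "A \<subseteq> Field r \<and> card_of A =o r"
      \<comment> \<open>At limit points of \<open>A\<close> of cofinality \<open>k\<close> there is
        a guess inside \<open>A\<close>, and its trace on \<open>A\<close> is itself.\<close>
      let ?E = "{d \<in> Field r. is_sup r (A \<inter> underS r d) d}"
      have "club r ?E" using A by (intro club_limit_points[OF assms(1) nat]) simp_all
      moreover have "\<exists>a\<in>R d. is_sup r (A \<inter> a) d" if d: "d \<in> ?E \<inter> S_cof r k" for d
      proof -
        obtain X where X: "X \<in> R d" "X \<subseteq> A" "is_sup r X d" using guess[of d A] d by auto
        then have "A \<inter> X = X" by auto
        then show ?thesis using X by (intro bexI[of _ X]) simp_all
      qed
      ultimately show "\<exists>E. club r E \<and> (\<forall>d\<in>E \<inter> S_cof r k. \<exists>a\<in>R d. is_sup r (A \<inter> a) d)"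
        by (intro exI[of _ ?E] conjI ballI)
    qed
    assume exp: "\<forall>(t :: 'a rel) (m :: 'a rel). Card_order t \<and> t <o r \<and> Card_order m \<and> m <o k \<longrightarrow>
      BNF_Cardinal_Arithmetic.cexp t m <o r"
    show "\<exists>R. (\<forall>d\<in>S_cof r k. R d \<subseteq> small_subsets r k d \<and> card_of (R d) <o r) \<and>
      (\<forall>a. (\<forall>d\<in>S_cof r k. a d \<subseteq> underS r d \<and> Restr r (a d) <=o k) \<longrightarrow>
        (\<exists>C. club r C \<and> (\<forall>d\<in>C \<inter> S_cof r k. a d \<in> R d)))"
    \<comment> \<open>All subsets of size at most \<open>k\<close> are taken, so the club can be all
      of \<open>Field r\<close>; the work lies in counting them.\<close>
    proof (intro exI[of _ "small_subsets r k"] conjI ballI allI impI subset_refl)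
      fix d assume "d \<in> S_cof r k"
      then have d: "d \<in> Field r" by (rule S_Field)
      show "card_of (small_subsets r k d) <o r"
      proof (rule small_subsets_ordLess[OF assms(1) B kleB, of d "P d" n "R d"])
        show "card_of (R d) <o r" using d by (rule R_card)
        show "y \<in> R d" if "a \<in> P d" "y \<subseteq> a" "card_of y <=o k" for a y
          using that unfolding R_def by auto
        show "BNF_Cardinal_Arithmetic.cexp t (card_of (B n)) <o r"
          if "Card_order t" "t <o r" for t :: "'a rel"
          using exp that Bk card_of_Card_order by metis
      qed (use P[OF d] in simp)
    next
      fix a :: "'a \<Rightarrow> 'a set"
      assume a: "\<forall>d\<in>S_cof r k. a d \<subseteq> underS r d \<and> Restr r (a d) <=o k"
      have "club r (Field r)"
        unfolding club_def using infinite_Card_order_limit[OF card inf] by auto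
      moreover have "a d \<in> small_subsets r k d" if d: "d \<in> S_cof r k" for d
      proof -
        have ad: "a d \<subseteq> underS r d" "Restr r (a d) <=o k" using a d by simp_all
        \<comment> \<open>Passing to fields turns the bound on the order type of \<open>a d\<close>
          into a bound on its size.\<close>
        have "Refl r" using wor unfolding order_on_defs by simp
        moreover have "a d \<subseteq> Field r" using ad(1) unfolding underS_def Field_def by auto
        ultimately have "Field (Restr r (a d)) = a d" by (rule Refl_Field_Restr2)
        then have "card_of (a d) <=o card_of (Field k)" using card_of_mono2[OF ad(2)] by simp
        moreover have "card_of (Field k) =o k"
          using k(1) unfolding regular_cardinal_def by (intro card_of_Field_ordIso) simp
        ultimately have "card_of (a d) <=o k" by (rule ordLeq_ordIso_trans)
        then show ?thesis using ad(1) unfolding small_subsets_def by simp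
      qed
      ultimately show "\<exists>C. club r C \<and> (\<forall>d\<in>C \<inter> S_cof r k. a d \<in> small_subsets r k d)"
        by (intro exI[of _ "Field r"]) simp
    qed
  qed
qed

end
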